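(* Let $(\hat\nu_k,\hat\nu_{k^+})_{k\ge1}$ be stochastic sequences of measures in $\mathcal M_+(\mathcal X)$, adapted to filtrations $(\mathfrak F_k)_k,(\mathfrak F_k^+)_k$ as in the context, satisfying the assumptions $(\hat{\mathcal H}_D)$, $(\hat{\mathcal H}^+_{\varepsilon,a})$ with $a\ge\frac{d}{2(2+d)}$, $(\hat{\mathcal H}^{\mathrm{smooth},1}_\varepsilon)$, $(\hat{\mathcal H}^{\mathrm{smooth},2}_\varepsilon)$ and $(\hat{\mathcal H}^\infty_{\mathrm{TV}})$ listed in the context. Let $\nu^\star$ be a minimizer of $J$ over $\mathcal M_+(\mathcal X)$. For any final horizon $K\ge2$ define $$\hat\rho_K:=\min_{1\le k\le K}\{J(\hat\nu_k)-J(\nu^\star)\}.$$ If the parameters are chosen as $$\alpha\le\frac{1}{\mathbf E_\infty}\sqrt{8\log 8},\qquad \beta\le\frac{1}{\alpha^{d/4}\sqrt K},\qquad \varepsilon_k=\frac1{\sqrt K},\qquad m_k=K ,$$ then $$\mathbb E[\hat\rho_K]\le C\,\alpha^{-1/2}\left(\frac{\log K}{K}\right)^{\frac{1}{2(2+d)}}$$ for a constant $C>0$ not depending on $K$.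
   Context: Setting. $\mathcal X\subset\mathbb R^d$ is compact, convex and equal to the closure of its interior. $\mathcal M(\mathcal X)$ is the space of finite signed measures on $\mathcal X$ with total variation norm $\|\cdot\|_{\mathrm{TV}}$, and $\mathcal M_+(\mathcal X)$ the nonnegative ones. $\mathbb H$ is a separable Hilbert space, $\Phi:\mathcal M(\mathcal X)\to\mathbb H$ is bounded, linear and weak-* continuous, so that $\Phi\nu=\int_{\mathcal X}\varphi_t\,d\nu(t)$ with $\varphi_t:=\Phi\delta_t$; the kernel is $K(s,t)=\langle\varphi_s,\varphi_t\rangle_{\mathbb H}$. Given $y\in\mathbb H$ and $\kappa>0$, $J(\nu)=\frac12\|y-\Phi\nu\|_{\mathbb H}^2+\kappa\|\nu\|_{\mathrm{TV}}$ on $\mathcal M_+(\mathcal X)$, and $J'_\nu(t)=\langle\varphi_t,\Phi\nu-y\rangle_{\mathbb H}+\kappa$. For $\nu\in\mathcal M_+(\mathcal X)$, $\|f\|_\nu^2:=\int_{\mathcal X}|f|^2d\nu$. Assumption on the problem: there are $c_{\mathcal P},C_{\mathcal P}>0$ such that $\|y\|_{\mathbb H}\le C_{\mathcal P}$; $K$ is twice continuously differentiable with $\max\{\|K\|_\infty,\|\nabla_sK\|_\infty,\|\nabla_s^2K\|_\infty\}\le C_{\mathcal P}$; $K(s,t)\ge c_{\mathcal P}$ and $K(t,t)=1$ for all $s,t\in\mathcal X$. Stochastic gradients: there is a random variable $Z$ with unbiased estimators $\widehat{J'_\nu}(t,Z)=J'_\nu(t)+\xi_\nu(t,Z)$ and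 $\widehat{D_\nu}(t,Z)=\nabla J'_\nu(t)+\zeta_\nu(t,Z)$, $\mathbb E_Z[\xi_\nu(t,Z)]=0$, $\mathbb E_Z[\zeta_\nu(t,Z)]=0$; $\mathbf E_\infty>0$ is a constant with $|\xi_\nu(t,Z)|\vee\|\zeta_\nu(t,Z)\|\le\mathbf E_\infty$ almost surely for all $t\in\mathcal X$; moreover $\widehat{J'_\nu}(t,Z)\ge\mathbf G\|\nu\|_{\mathrm{TV}}-\mathbf H+\kappa$ a.s. for constants $\mathbf G,\mathbf H>0$, and $t\mapsto\widehat{J'_\nu}(t,Z)$ is a.s. Lipschitz with a uniform constant. Filtrations: increasing $\sigma$-algebras with $\mathfrak F_{k-1}\subset\mathfrak F_{k-1}^+\subset\mathfrak F_k\subset\mathfrak F_k^+$, $\hat\nu_k$ is $\mathfrak F_k$-measurable and $\hat\nu_{k^+}$ is $\mathfrak F_k^+$-measurable. Assumptions on the sequences (parameters: $\alpha,\beta>0$; exploration schedule $\varepsilon_k>0$; mini-batch sizes $m_k\ge1$; $\lambda$ is Lebesgue measure; $C,c>0$ are generic constants that may change from line to line and are independent of $k$ and $d$): $(\hat{\mathcal H}^\infty_{\mathrm{TV}})$: there is a constant $C_{\mathrm{TV}}$ with $\|\hat\nu_k\|_{\mathrm{TV}}\le C_{\mathrm{TV}}$ a.s. for all $k$. $(\hat{\mathcal H}_D)$: for any $k\ge1$, $\mathbb E[J(\hat\nu_{k^+})\mid\mathfrak F_k]-J(\hat\nu_k)\le-\frac\alpha2\|J'_{\hat\nu_k}\|^2_{\hat\nu_k}+C\left(\frac{\alpha^2}{m_k}+\beta^2+\frac{\beta}{m_k}\right)$.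 $(\hat{\mathcal H}^+_{\varepsilon,a})$, for a given $a>0$: for any $k\ge0$ and Borel $\mathcal B\subseteq\mathcal X$, $\mathbb E[\hat\nu_{k+1}(\mathcal B)\mid\mathfrak F_k^+]\ge c\,\varepsilon_k\,\lambda(\mathcal B\cap\{J'_{\hat\nu_{k^+}}<0\})-C\varepsilon_km_k^{-a}$. $(\hat{\mathcal H}^{\mathrm{smooth},1}_\varepsilon)$: for any $k\ge1$, $\mathbb E[J(\hat\nu_{k+1})-J(\hat\nu_{k^+})\mid\mathfrak F_k^+]\le C\left(\varepsilon_k^2+\varepsilon_k\sqrt{\frac{\log m_k}{m_k}}\right)$. $(\hat{\mathcal H}^{\mathrm{smooth},2}_\varepsilon)$: for any $k\ge1$, $\|J'_{\hat\nu_{k+1}}-J'_{\hat\nu_{k^+}}\|_\infty\le C\varepsilon_k$ a.s. *)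

theory Defs
  imports "HOL-Probability.Probability"
begin

abbreviation borel_on :: "'a::topological_space set \<Rightarrow> 'a measure" where
  "borel_on X \<equiv> restrict_space borel X"

text \<open>A finite signed measure is a real-valued, countably additive set function on the Borel
  sets of \<open>X\<close>, extended by 0 to all other sets.\<close>

definition signed_measures :: "'a::topological_space set \<Rightarrow> ('a set \<Rightarrow> real) set" where
  "signed_measures X =
    {\<mu>. (\<forall>A. A \<notin> sets (borel_on X) \<longrightarrow> \<mu> A = 0) \<and>
        (\<forall>A :: nat \<Rightarrow> 'a set. range A \<subseteq> sets (borel_on X) \<and> disjoint_family A \<longrightarrow>
            (\<lambda>n. \<mu> (A n)) sums \<mu> (\<Union>n. A n))}"

text \<open>Nonnegative finite measures are taken as elements of the library type \<open>'a measure\<close>;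
  the set function \<open>measure \<nu>\<close> vanishes off \<open>sets \<nu>\<close> and is the associated element of
  \<open>signed_measures X\<close>.\<close>

definition nonneg_measures :: "'a::topological_space set \<Rightarrow> 'a measure set" where
  "nonneg_measures X = {\<nu>. finite_measure \<nu> \<and> space \<nu> = X \<and> sets \<nu> = sets (borel_on X)}"

text \<open>Jordan decomposition: the positive part is \<open>\<mu>\<^sup>+(A) = sup {\<mu>(B) | B \<subseteq> A}\<close>.\<close>

definition pos_part :: "'a::topological_space set \<Rightarrow> ('a set \<Rightarrow> real) \<Rightarrow> 'a measure" where
  "pos_part X \<mu> = measure_of X (sets (borel_on X))
     (\<lambda>A. SUP B\<in>{B \<in> sets (borel_on X). B \<subseteq> A}. ennreal (\<mu> B))"

definition neg_part :: "'a::topological_space set \<Rightarrow> ('a set \<Rightarrow> real) \<Rightarrow> 'a measure" where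
  "neg_part X \<mu> = pos_part X (\<lambda>A. - \<mu> A)"

definition tv_norm :: "'a::topological_space set \<Rightarrow> ('a set \<Rightarrow> real) \<Rightarrow> real" where
  "tv_norm X \<mu> = measure (pos_part X \<mu>) X + measure (neg_part X \<mu>) X"

definition signed_integral ::
    "'a::topological_space set \<Rightarrow> ('a set \<Rightarrow> real) \<Rightarrow> ('a \<Rightarrow> real) \<Rightarrow> real" where
  "signed_integral X \<mu> f = (\<integral>t. f t \<partial>pos_part X \<mu>) - (\<integral>t. f t \<partial>neg_part X \<mu>)"

definition weak_star_topology :: "'a::topological_space set \<Rightarrow> ('a set \<Rightarrow> real) topology" where
  "weak_star_topology X = topology_generated_by
     {{\<mu> \<in> signed_measures X. signed_integral X \<mu> f \<in> U} | f U. continuous_on X f \<and> open U}"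

definition weak_topology :: "'h::real_inner topology" where
  "weak_topology = topology_generated_by {{x. h \<bullet> x \<in> U} | h U. open U}"

text \<open>All derivatives are Frechet derivatives relative to the set (\<open>at x within X\<close>). For a convex
  set with nonempty interior they are unique, also at boundary points.\<close>

definition gradient_on :: "'a::euclidean_space set \<Rightarrow> ('a \<Rightarrow> real) \<Rightarrow> 'a \<Rightarrow> 'a" where
  "gradient_on X f x = (THE g. (f has_derivative (\<lambda>h. g \<bullet> h)) (at x within X))"

definition hessian_on :: "'a::euclidean_space set \<Rightarrow> ('a \<Rightarrow> real) \<Rightarrow> 'a \<Rightarrow> 'a \<Rightarrow> 'a" where
  "hessian_on X f x = frechet_derivative (gradient_on X f) (at x within X)"

definition C2_on :: "'b::real_normed_vector set \<Rightarrow> ('b \<Rightarrow> real) \<Rightarrow> bool" where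
  "C2_on S f \<longleftrightarrow> (\<exists>(f' :: 'b \<Rightarrow> 'b \<Rightarrow>\<^sub>L real) (f'' :: 'b \<Rightarrow> 'b \<Rightarrow>\<^sub>L ('b \<Rightarrow>\<^sub>L real)).
     (\<forall>x\<in>S. (f has_derivative blinfun_apply (f' x)) (at x within S)) \<and>
     (\<forall>x\<in>S. (f' has_derivative blinfun_apply (f'' x)) (at x within S)) \<and>
     continuous_on S f'')"

definition domain_ok :: "'a::euclidean_space set \<Rightarrow> bool" where
  "domain_ok X \<longleftrightarrow> compact X \<and> convex X \<and> X = closure (interior X)"

text \<open>On the Hilbert space side continuity refers to the weak topology: a linear map that is
  continuous from the weak-* to the norm topology has finite rank.\<close>

definition measurement_operator ::
    "'a::euclidean_space set \<Rightarrow> (('a set \<Rightarrow> real) \<Rightarrow> 'h::real_inner) \<Rightarrow> bool" where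
  "measurement_operator X \<Phi> \<longleftrightarrow>
     (\<forall>\<mu>\<in>signed_measures X. \<forall>\<mu>'\<in>signed_measures X. \<Phi> (\<lambda>A. \<mu> A + \<mu>' A) = \<Phi> \<mu> + \<Phi> \<mu>') \<and>
     (\<forall>r. \<forall>\<mu>\<in>signed_measures X. \<Phi> (\<lambda>A. r * \<mu> A) = r *\<^sub>R \<Phi> \<mu>) \<and>
     (\<exists>B. \<forall>\<mu>\<in>signed_measures X. norm (\<Phi> \<mu>) \<le> B * tv_norm X \<mu>) \<and>
     continuous_map (weak_star_topology X) weak_topology \<Phi>"

definition feature ::
    "'a::topological_space set \<Rightarrow> (('a set \<Rightarrow> real) \<Rightarrow> 'h) \<Rightarrow> 'a \<Rightarrow> 'h" where
  "feature X \<Phi> t = \<Phi> (measure (return (borel_on X) t))"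

definition kern ::
    "'a::topological_space set \<Rightarrow> (('a set \<Rightarrow> real) \<Rightarrow> 'h::real_inner) \<Rightarrow> 'a \<Rightarrow> 'a \<Rightarrow> real" where
  "kern X \<Phi> s t = feature X \<Phi> s \<bullet> feature X \<Phi> t"

definition objective ::
    "'a::topological_space set \<Rightarrow> (('a set \<Rightarrow> real) \<Rightarrow> 'h::real_inner) \<Rightarrow> 'h \<Rightarrow> real \<Rightarrow>
     'a measure \<Rightarrow> real" where
  "objective X \<Phi> y \<kappa> \<nu> =
     1 / 2 * (norm (y - \<Phi> (measure \<nu>)))\<^sup>2 + \<kappa> * tv_norm X (measure \<nu>)"

definition objective' ::
    "'a::topological_space set \<Rightarrow> (('a set \<Rightarrow> real) \<Rightarrow> 'h::real_inner) \<Rightarrow> 'h \<Rightarrow> real \<Rightarrow>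
     'a measure \<Rightarrow> 'a \<Rightarrow> real" where
  "objective' X \<Phi> y \<kappa> \<nu> t = feature X \<Phi> t \<bullet> (\<Phi> (measure \<nu>) - y) + \<kappa>"

definition sq_norm :: "'a measure \<Rightarrow> ('a \<Rightarrow> real) \<Rightarrow> real" where
  "sq_norm \<nu> f = (\<integral>t. \<bar>f t\<bar>\<^sup>2 \<partial>\<nu>)"

definition problem_assumption ::
    "'a::euclidean_space set \<Rightarrow> (('a set \<Rightarrow> real) \<Rightarrow> 'h::real_inner) \<Rightarrow> 'h \<Rightarrow> real \<Rightarrow> real \<Rightarrow> bool" where
  "problem_assumption X \<Phi> y cP CP \<longleftrightarrow>
     0 < cP \<and> 0 < CP \<and> norm y \<le> CP \<and>
     C2_on (X \<times> X) (\<lambda>(s, t). kern X \<Phi> s t) \<and>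
     (\<forall>s\<in>X. \<forall>t\<in>X. \<bar>kern X \<Phi> s t\<bar> \<le> CP \<and>
        norm (gradient_on X (\<lambda>s. kern X \<Phi> s t) s) \<le> CP \<and>
        onorm (hessian_on X (\<lambda>s. kern X \<Phi> s t) s) \<le> CP) \<and>
     (\<forall>s\<in>X. \<forall>t\<in>X. cP \<le> kern X \<Phi> s t) \<and>
     (\<forall>t\<in>X. kern X \<Phi> t t = 1)"

text \<open>\<open>Q\<close> is the law of the random variable \<open>Z\<close>; \<open>\<xi>\<close> and \<open>\<zeta>\<close> are the centred noises
  \<open>J_hat - J'\<close> and \<open>D_hat - \<nabla>J'\<close>. The noise bound and the Lipschitz constant are uniform over the
  measures of total variation at most \<open>CTV\<close>: a Lipschitz constant that is uniform over all of
  \<open>nonneg_measures X\<close> would force the kernel to be constant.\<close>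

definition stochastic_gradients ::
    "'a::euclidean_space set \<Rightarrow> (('a set \<Rightarrow> real) \<Rightarrow> 'h::real_inner) \<Rightarrow> 'h \<Rightarrow> real \<Rightarrow> real \<Rightarrow>
     'z measure \<Rightarrow> ('a measure \<Rightarrow> 'a \<Rightarrow> 'z \<Rightarrow> real) \<Rightarrow> ('a measure \<Rightarrow> 'a \<Rightarrow> 'z \<Rightarrow> 'a) \<Rightarrow>
     real \<Rightarrow> real \<Rightarrow> real \<Rightarrow> bool" where
  "stochastic_gradients X \<Phi> y \<kappa> CTV Q J_hat D_hat Einf G H \<longleftrightarrow>
    (let J' = objective' X \<Phi> y \<kappa>;
         \<xi> = (\<lambda>\<nu> t z. J_hat \<nu> t z - J' \<nu> t);
         \<zeta> = (\<lambda>\<nu> t z. D_hat \<nu> t z - gradient_on X (J' \<nu>) t)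
     in prob_space Q \<and> 0 < Einf \<and> 0 < G \<and> 0 < H \<and>
        (\<forall>\<nu>\<in>nonneg_measures X. \<forall>t\<in>X.
           integrable Q (\<xi> \<nu> t) \<and> (\<integral>z. \<xi> \<nu> t z \<partial>Q) = 0 \<and>
           integrable Q (\<zeta> \<nu> t) \<and> (\<integral>z. \<zeta> \<nu> t z \<partial>Q) = 0) \<and>
        (\<forall>\<nu>\<in>nonneg_measures X. tv_norm X (measure \<nu>) \<le> CTV \<longrightarrow>
           (\<forall>t\<in>X. AE z in Q. max \<bar>\<xi> \<nu> t z\<bar> (norm (\<zeta> \<nu> t z)) \<le> Einf)) \<and>
        (\<forall>\<nu>\<in>nonneg_measures X. \<forall>t\<in>X. AE z in Q.
           J_hat \<nu> t z \<ge> G * tv_norm X (measure \<nu>) - H + \<kappa>) \<and>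
        (\<exists>L. \<forall>\<nu>\<in>nonneg_measures X. tv_norm X (measure \<nu>) \<le> CTV \<longrightarrow>
           (AE z in Q. L-lipschitz_on X (\<lambda>t. J_hat \<nu> t z))))"

text \<open>\<open>M\<close> is the underlying probability space, \<open>\<nu> k\<close> and \<open>\<nu>p k\<close> are the random measures with
  indices \<open>k\<close> and \<open>k\<^sup>+\<close>, and \<open>F k\<close>, \<open>Fp k\<close> the corresponding \<open>\<sigma>\<close>-algebras. Measurability of a random
  measure is measurability of all its evaluations on Borel sets.\<close>

definition measure_adapted ::
    "'a::topological_space set \<Rightarrow> 'w measure \<Rightarrow> (nat \<Rightarrow> 'w measure) \<Rightarrow> (nat \<Rightarrow> 'w \<Rightarrow> 'a measure) \<Rightarrow> bool" where
  "measure_adapted X M F \<nu> \<longleftrightarrow>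
     (\<forall>k. (\<forall>\<omega>\<in>space M. \<nu> k \<omega> \<in> nonneg_measures X) \<and>
          (\<forall>B\<in>sets (borel_on X). (\<lambda>\<omega>. measure (\<nu> k \<omega>) B) \<in> borel_measurable (F k)))"

definition interlaced_filtrations ::
    "'w measure \<Rightarrow> (nat \<Rightarrow> 'w measure) \<Rightarrow> (nat \<Rightarrow> 'w measure) \<Rightarrow> bool" where
  "interlaced_filtrations M F Fp \<longleftrightarrow>
     (\<forall>k. subalgebra M (F k) \<and> subalgebra M (Fp k) \<and>
          subalgebra (Fp k) (F k) \<and> subalgebra (F (Suc k)) (Fp k))"

definition hyp_TV ::
    "'a::topological_space set \<Rightarrow> 'w measure \<Rightarrow> (nat \<Rightarrow> 'w \<Rightarrow> 'a measure) \<Rightarrow> real \<Rightarrow> bool" where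
  "hyp_TV X M \<nu> CTV \<longleftrightarrow> (\<forall>k. AE \<omega> in M. tv_norm X (measure (\<nu> k \<omega>)) \<le> CTV)"

text \<open>In the following hypotheses \<open>J\<close> and \<open>J'\<close> are the objective and its first variation, and
  \<open>C\<close>, \<open>c\<close> the generic constants. Integrability of \<open>J (\<nu>p k)\<close> is part of \<open>hyp_D\<close> because
  \<open>real_cond_exp\<close> takes junk values where a conditional expectation is infinite. It is implied
  by the inequality with extended-real conditional expectations, \<open>J (\<nu> k)\<close> being bounded.\<close>

definition hyp_D ::
    "('a measure \<Rightarrow> real) \<Rightarrow> ('a measure \<Rightarrow> 'a \<Rightarrow> real) \<Rightarrow> 'w measure \<Rightarrow> (nat \<Rightarrow> 'w measure) \<Rightarrow>
     (nat \<Rightarrow> 'w \<Rightarrow> 'a measure) \<Rightarrow> (nat \<Rightarrow> 'w \<Rightarrow> 'a measure) \<Rightarrow>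
     real \<Rightarrow> real \<Rightarrow> (nat \<Rightarrow> nat) \<Rightarrow> real \<Rightarrow> bool" where
  "hyp_D J J' M F \<nu> \<nu>p \<alpha> \<beta> m C \<longleftrightarrow>
     (\<forall>k\<ge>1. integrable M (\<lambda>\<omega>. J (\<nu>p k \<omega>)) \<and>
       (AE \<omega> in M.
          real_cond_exp M (F k) (\<lambda>\<omega>. J (\<nu>p k \<omega>)) \<omega> - J (\<nu> k \<omega>)
          \<le> - (\<alpha> / 2) * sq_norm (\<nu> k \<omega>) (J' (\<nu> k \<omega>))
             + C * (\<alpha>\<^sup>2 / real (m k) + \<beta>\<^sup>2 + \<beta> / real (m k))))"

definition hyp_plus ::
    "'a::euclidean_space set \<Rightarrow> ('a measure \<Rightarrow> 'a \<Rightarrow> real) \<Rightarrow> 'w measure \<Rightarrow> (nat \<Rightarrow> 'w measure) \<Rightarrow>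
     (nat \<Rightarrow> 'w \<Rightarrow> 'a measure) \<Rightarrow> (nat \<Rightarrow> 'w \<Rightarrow> 'a measure) \<Rightarrow>
     (nat \<Rightarrow> real) \<Rightarrow> (nat \<Rightarrow> nat) \<Rightarrow> real \<Rightarrow> real \<Rightarrow> real \<Rightarrow> bool" where
  "hyp_plus X J' M Fp \<nu> \<nu>p \<epsilon> m a c C \<longleftrightarrow>
     (\<forall>k. \<forall>B\<in>sets (borel_on X).
       (AE \<omega> in M.
          real_cond_exp M (Fp k) (\<lambda>\<omega>. measure (\<nu> (Suc k) \<omega>) B) \<omega>
          \<ge> c * \<epsilon> k * measure lborel (B \<inter> {t\<in>X. J' (\<nu>p k \<omega>) t < 0})
             - C * \<epsilon> k * real (m k) powr (- a)))"

definition hyp_smooth1 ::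
    "('a measure \<Rightarrow> real) \<Rightarrow> 'w measure \<Rightarrow> (nat \<Rightarrow> 'w measure) \<Rightarrow>
     (nat \<Rightarrow> 'w \<Rightarrow> 'a measure) \<Rightarrow> (nat \<Rightarrow> 'w \<Rightarrow> 'a measure) \<Rightarrow>
     (nat \<Rightarrow> real) \<Rightarrow> (nat \<Rightarrow> nat) \<Rightarrow> real \<Rightarrow> bool" where
  "hyp_smooth1 J M Fp \<nu> \<nu>p \<epsilon> m C \<longleftrightarrow>
     (\<forall>k\<ge>1. AE \<omega> in M.
        real_cond_exp M (Fp k) (\<lambda>\<omega>. J (\<nu> (Suc k) \<omega>) - J (\<nu>p k \<omega>)) \<omega>
        \<le> C * ((\<epsilon> k)\<^sup>2 + \<epsilon> k * sqrt (ln (real (m k)) / real (m k))))"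

definition hyp_smooth2 ::
    "'a set \<Rightarrow> ('a measure \<Rightarrow> 'a \<Rightarrow> real) \<Rightarrow> 'w measure \<Rightarrow>
     (nat \<Rightarrow> 'w \<Rightarrow> 'a measure) \<Rightarrow> (nat \<Rightarrow> 'w \<Rightarrow> 'a measure) \<Rightarrow> (nat \<Rightarrow> real) \<Rightarrow> real \<Rightarrow> bool" where
  "hyp_smooth2 X J' M \<nu> \<nu>p \<epsilon> C \<longleftrightarrow>
     (\<forall>k\<ge>1. AE \<omega> in M. \<forall>t\<in>X. \<bar>J' (\<nu> (Suc k) \<omega>) t - J' (\<nu>p k \<omega>) t\<bar> \<le> C * \<epsilon> k)"

definition best_gap ::
    "('a measure \<Rightarrow> real) \<Rightarrow> 'a measure \<Rightarrow> (nat \<Rightarrow> 'w \<Rightarrow> 'a measure) \<Rightarrow> nat \<Rightarrow> 'w \<Rightarrow> real" where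
  "best_gap J \<nu>star \<nu> K \<omega> = Min ((\<lambda>k. J (\<nu> k \<omega>) - J \<nu>star) ` {1..K})"

end

theory Submission
  imports Defs
begin

text \<open>
  The objective is convex in the measure, so the gap of an iterate \<open>\<nu>\<close> is at most
  \<open>\<integral>J'\<^sub>\<nu> d\<nu> - \<integral>J'\<^sub>\<nu> d\<nu>star\<close>. The first integral is small when \<open>\<parallel>J'\<^sub>\<nu>\<parallel>\<^sub>\<nu>\<close> is small, and the second
  one when \<open>J'\<^sub>\<nu>\<close> is nowhere very negative (\<open>objective_gap_le\<close>). Both are paid for by the same budget:
  the descent hypothesis bounds \<open>\<alpha>/2 \<parallel>J'\<parallel>\<^sup>2\<close> at step \<open>k\<close> by the expected decrease of the objective plus
  error terms, the exploration step hardly increases the objective, and the decreases telescope. With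
  \<open>\<tau>\<close> denoting the claimed rate, the average over \<open>k \<le> K\<close> of \<open>E \<parallel>J'\<parallel>\<^sup>2\<close> is \<open>O(\<tau>\<^bsup>d+2\<^esup>/\<surd>K)\<close>
  (\<open>averaged_descent_le\<close>).

  A dip of \<open>J'\<close> below zero costs gradient norm (\<open>negative_part_step\<close>). If \<open>J'\<close> takes the value \<open>-\<delta>\<close>
  somewhere at the intermediate measure, Lipschitz continuity keeps it below \<open>-\<delta>/2\<close> on a ball whose radius
  \<open>r\<close> is of order \<open>\<delta>\<close>, also after the next update. By convexity the domain contains a fixed proportion of
  that ball, so exploration puts mass of order \<open>\<epsilon> r\<^sup>d\<close> there, and the next measure has
  \<open>E \<parallel>J'\<parallel>\<^sup>2\<close> at least of order \<open>\<epsilon> r\<^sup>d \<delta>\<^sup>2\<close>.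

  The argument needs only one scale. Take balls of radius \<open>r = R \<tau>\<close> and ignore dips smaller than a
  threshold \<open>\<theta> = A \<tau>\<close>, which contribute \<open>O(\<tau>)\<close> to the gap anyway. Larger dips satisfy
  \<open>\<delta>\<^sup>2 \<ge> \<theta> \<delta>\<close>, so the cost is linear in \<open>\<delta>\<close>: an expected excess \<open>E w\<close> requires
  \<open>E \<parallel>J'\<parallel>\<^sup>2 \<ge> const \<epsilon> \<tau>\<^bsup>d+1\<^esup> E w\<close>. With \<open>\<epsilon> = 1/\<surd>K\<close> and the budget above this gives
  \<open>E w = O(\<tau>)\<close> on average, and the minimum over \<open>k\<close> is at most the average.
  The location of the deepest dip is random whereas exploration concerns fixed sets; the balls are
  therefore centred at a finite net and the centre is a measurable selection from it, so the hypothesis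
  is applied to finitely many fixed balls (\<open>expectation_selected_ge\<close>). When \<open>\<tau>\<close> is not small, the bound
  that the total variation gives on the objective is already enough.

  The analytic input is \<open>h \<bullet> \<Phi> \<nu> = \<integral> h \<bullet> \<phi>\<^sub>t d\<nu>(t)\<close> (\<open>measurement_operator_eq_integral\<close>), which comes from
  weak-* continuity along discretizations of \<open>\<nu>\<close>, and the Lipschitz continuity of \<open>\<phi>\<close>, which comes from
  the second differences of the kernel (\<open>feature_lipschitz\<close>).
\<close>

section \<open>Nonnegative measures as signed measures\<close>

lemma nonneg_measuresD:
  assumes "\<nu> \<in> nonneg_measures X"
  shows "finite_measure \<nu>" "space \<nu> = X" "sets \<nu> = sets (borel_on X)"
  using assms by (auto simp: nonneg_measures_def)

lemma measure_in_signed_measures: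
  assumes "\<nu> \<in> nonneg_measures X"
  shows "measure \<nu> \<in> signed_measures X"
proof -
  interpret finite_measure \<nu> using nonneg_measuresD(1)[OF assms] .
  show ?thesis
    unfolding signed_measures_def using nonneg_measuresD(3)[OF assms]
    by (auto simp: measure_notin_sets intro!: finite_measure_UNION)
qed

lemma signed_measures_add:
  "\<mu> \<in> signed_measures X \<Longrightarrow> \<mu>' \<in> signed_measures X \<Longrightarrow> (\<lambda>A. \<mu> A + \<mu>' A) \<in> signed_measures X"
  unfolding signed_measures_def by (auto intro!: sums_add)

lemma signed_measures_scale:
  "\<mu> \<in> signed_measures X \<Longrightarrow> (\<lambda>A. r * \<mu> A) \<in> signed_measures X"
  unfolding signed_measures_def by (auto intro!: sums_mult)

text \<open>For a nonnegative measure the supremum in the Jordan decomposition is attained at the set itself, so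
  \<open>tv_norm\<close> and \<open>signed_integral\<close> reduce to the total mass and the ordinary integral.\<close>

lemma pos_part_measure:
  assumes "\<nu> \<in> nonneg_measures X"
  shows "pos_part X (measure \<nu>) = \<nu>"
proof -
  interpret finite_measure \<nu> using nonneg_measuresD(1)[OF assms] .
  note [simp] = nonneg_measuresD(2,3)[OF assms]
  have "(SUP B\<in>{B \<in> sets (borel_on X). B \<subseteq> A}. ennreal (measure \<nu> B)) = emeasure \<nu> A"
    if "A \<in> sigma_sets X (sets (borel_on X))" for A
  proof -
    have A: "A \<in> sets \<nu>" using that sets.sigma_sets_eq[of \<nu>] by simp
    show ?thesis
    proof (rule antisym)
      show "(SUP B\<in>{B \<in> sets (borel_on X). B \<subseteq> A}. ennreal (measure \<nu> B)) \<le> emeasure \<nu> A"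
        using A by (auto intro!: SUP_least emeasure_mono simp flip: emeasure_eq_measure)
      show "emeasure \<nu> A \<le> (SUP B\<in>{B \<in> sets (borel_on X). B \<subseteq> A}. ennreal (measure \<nu> B))"
        using A by (auto intro!: SUP_upper simp: emeasure_eq_measure)
    qed
  qed
  then have "pos_part X (measure \<nu>) = measure_of X (sets (borel_on X)) (emeasure \<nu>)"
    unfolding pos_part_def using sets.space_closed[of \<nu>] by (intro measure_of_eq) auto
  also have "\<dots> = \<nu>" using measure_of_of_measure[of \<nu>] by simp
  finally show ?thesis .
qed

lemma neg_part_measure:
  assumes "\<nu> \<in> nonneg_measures X"
  shows "neg_part X (measure \<nu>) = null_measure \<nu>"
proof -
  note [simp] = nonneg_measuresD(2,3)[OF assms]
  have "(SUP B\<in>{B \<in> sets (borel_on X). B \<subseteq> A}. ennreal (- measure \<nu> B)) = 0" for A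
  proof -
    have "{B \<in> sets (borel_on X). B \<subseteq> A} \<noteq> {}" by auto
    then show ?thesis by (simp add: ennreal_neg)
  qed
  then show ?thesis
    unfolding neg_part_def pos_part_def null_measure_def by simp
qed

lemma tv_norm_measure:
  "\<nu> \<in> nonneg_measures X \<Longrightarrow> tv_norm X (measure \<nu>) = measure \<nu> X"
  by (simp add: tv_norm_def pos_part_measure neg_part_measure)

lemma signed_integral_measure:
  "\<nu> \<in> nonneg_measures X \<Longrightarrow> signed_integral X (measure \<nu>) f = (\<integral>t. f t \<partial>\<nu>)"
  by (simp add: signed_integral_def pos_part_measure neg_part_measure)

section \<open>Integral representation of the measurement operator\<close>

text \<open>Convergence of the integrals of all continuous functions puts the sequence eventually into every
  subbasic open set around the limit, and this property survives finite intersections and unions.\<close>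

lemma weak_star_convergence:
  assumes lim: "\<And>f :: 'a::topological_space \<Rightarrow> real. continuous_on X f \<Longrightarrow>
      (\<lambda>n. signed_integral X (\<mu> n) f) \<longlonglongrightarrow> signed_integral X \<mu>' f"
    and mem: "\<And>n. \<mu> n \<in> signed_measures X" "\<mu>' \<in> signed_measures X"
    and op: "openin (weak_star_topology X) U" "\<mu>' \<in> U"
  shows "\<forall>\<^sub>F n in sequentially. \<mu> n \<in> U"
proof -
  have "generate_topology_on {{\<mu> \<in> signed_measures X. signed_integral X \<mu> f \<in> V} | f V. continuous_on X f \<and> open V} U"
    using op by (simp add: weak_star_topology_def openin_topology_generated_by_iff)
  then show ?thesis using op(2)
  proof (induction rule: generate_topology_on.induct)
    case (Int a b) then show ?case by (auto intro: eventually_conj)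
  next
    case (UN K)
    then obtain k where "k \<in> K" "\<mu>' \<in> k" by blast
    with UN have "\<forall>\<^sub>F n in sequentially. \<mu> n \<in> k" by blast
    then show ?case by (rule eventually_mono) (use \<open>k \<in> K\<close> in blast)
  next
    case (Basis s)
    then obtain f V where s: "s = {\<mu> \<in> signed_measures X. signed_integral X \<mu> f \<in> V}"
      and fV: "continuous_on X f" "open V" by auto
    have "\<forall>\<^sub>F n in sequentially. signed_integral X (\<mu> n) f \<in> V"
      using topological_tendstoD[OF lim[OF fV(1)] fV(2)] Basis s by blast
    then show ?case using mem by (auto simp: s)
  qed auto
qed

lemma measurement_operator_tendsto:
  assumes \<Phi>: "measurement_operator X \<Phi>"
    and lim: "\<And>f :: 'a::euclidean_space \<Rightarrow> real. continuous_on X f \<Longrightarrow>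
      (\<lambda>n. signed_integral X (\<mu> n) f) \<longlonglongrightarrow> signed_integral X \<mu>' f"
    and mem: "\<And>n. \<mu> n \<in> signed_measures X" "\<mu>' \<in> signed_measures X"
  shows "(\<lambda>n. h \<bullet> \<Phi> (\<mu> n)) \<longlonglongrightarrow> h \<bullet> \<Phi> \<mu>'"
proof (rule topological_tendstoI)
  fix U :: "real set" assume U: "open U" "h \<bullet> \<Phi> \<mu>' \<in> U"
  have 1: "openin weak_topology {x. h \<bullet> x \<in> U}"
    unfolding weak_topology_def using U by (intro topology_generated_by_Basis) auto
  have 2: "continuous_map (weak_star_topology X) weak_topology \<Phi>"
    using \<Phi> by (simp add: measurement_operator_def)
  have tsp: "signed_measures X \<subseteq> topspace (weak_star_topology X)"
  proof (rule openin_subset)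
    have "signed_measures X = {\<mu> \<in> signed_measures X. signed_integral X \<mu> (\<lambda>_. 0) \<in> UNIV}" by simp
    then show "openin (weak_star_topology X) (signed_measures X)"
      unfolding weak_star_topology_def
      by (intro topology_generated_by_Basis) (use continuous_on_const open_UNIV in blast)
  qed
  have "\<forall>\<^sub>F n in sequentially. \<mu> n \<in> {x \<in> topspace (weak_star_topology X). \<Phi> x \<in> {x. h \<bullet> x \<in> U}}"
  proof (rule weak_star_convergence[OF lim mem openin_continuous_map_preimage[OF 2 1]])
    show "\<mu>' \<in> {x \<in> topspace (weak_star_topology X). \<Phi> x \<in> {x. h \<bullet> x \<in> U}}"
      using U(2) mem(2) tsp by blast
  qed
  then show "\<forall>\<^sub>F n in sequentially. h \<bullet> \<Phi> (\<mu> n) \<in> U"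
    by (rule eventually_mono) auto
qed

text \<open>Measurable selection among finitely many candidates: a new candidate is taken whenever it is at least
  as good as the selected one. It is used to round points to a net and to locate the deepest dip of the
  first variation.\<close>

lemma finite_argmax_measurable:
  fixes f :: "'w \<Rightarrow> 'a \<Rightarrow> real"
  assumes "finite S" "S \<noteq> {}" and "\<And>t. t \<in> S \<Longrightarrow> (\<lambda>w. f w t) \<in> borel_measurable N"
  obtains \<sigma> where "\<And>w. \<sigma> w \<in> S" "\<And>w t. t \<in> S \<Longrightarrow> f w t \<le> f w (\<sigma> w)"
    "\<And>t. {w \<in> space N. \<sigma> w = t} \<in> sets N" "(\<lambda>w. f w (\<sigma> w)) \<in> borel_measurable N"
proof -
  have "\<exists>\<sigma>. (\<forall>w. \<sigma> w \<in> S) \<and> (\<forall>w. \<forall>t\<in>S. f w t \<le> f w (\<sigma> w)) \<and>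
      (\<forall>t. {w \<in> space N. \<sigma> w = t} \<in> sets N) \<and> (\<lambda>w. f w (\<sigma> w)) \<in> borel_measurable N"
    using assms
  proof (induction rule: finite_ne_induct)
    case (singleton x)
    then show ?case by (intro exI[of _ "\<lambda>_. x"]) auto
  next
    case (insert x S)
    have "\<exists>\<sigma>. (\<forall>w. \<sigma> w \<in> S) \<and> (\<forall>w. \<forall>t\<in>S. f w t \<le> f w (\<sigma> w)) \<and>
      (\<forall>t. {w \<in> space N. \<sigma> w = t} \<in> sets N) \<and> (\<lambda>w. f w (\<sigma> w)) \<in> borel_measurable N"
      using insert.prems by (intro insert.IH) simp
    then obtain \<sigma> where \<sigma>: "\<And>w. \<sigma> w \<in> S" "\<And>w t. t \<in> S \<Longrightarrow> f w t \<le> f w (\<sigma> w)"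
      "\<And>t. {w \<in> space N. \<sigma> w = t} \<in> sets N" and [measurable]: "(\<lambda>w. f w (\<sigma> w)) \<in> borel_measurable N"
      by (elim exE conjE) (rule that, auto)
    have [measurable]: "(\<lambda>w. f w x) \<in> borel_measurable N" using insert.prems by auto
    let ?\<sigma> = "\<lambda>w. if f w (\<sigma> w) \<le> f w x then x else \<sigma> w"
    have "{w \<in> space N. ?\<sigma> w = t} \<in> sets N" for t
    proof -
      have [measurable]: "Measurable.pred N (\<lambda>w. \<sigma> w = t)" using \<sigma>(3) by (simp add: pred_def)
      have "{w \<in> space N. ?\<sigma> w = t} =
         {w \<in> space N. if f w (\<sigma> w) \<le> f w x then x = t else \<sigma> w = t}" by auto
      also have "\<dots> \<in> sets N" by measurable
      finally show ?thesis .
    qed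
    moreover have "(\<lambda>w. f w (?\<sigma> w)) \<in> borel_measurable N"
    proof -
      have "(\<lambda>w. f w (?\<sigma> w)) = (\<lambda>w. if f w (\<sigma> w) \<le> f w x then f w x else f w (\<sigma> w))" by auto
      then show ?thesis by simp
    qed
    moreover have "f w t \<le> f w (?\<sigma> w)" if "t \<in> insert x S" for w t
      using that \<sigma>(2)[of t w] by (auto simp: not_le intro: less_imp_le)
    ultimately show ?case using \<sigma>(1) by (intro exI[of _ ?\<sigma>]) auto
  qed
  then show thesis using that by metis
qed

lemma compact_finite_net:
  fixes X :: "'a::metric_space set"
  assumes "compact X" "e > 0"
  obtains T where "finite T" "T \<subseteq> X" "\<And>x. x \<in> X \<Longrightarrow> \<exists>t\<in>T. dist x t < e"
proof -
  have cover: "X \<subseteq> (\<Union>x\<in>X. ball x e)" using assms(2) by auto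
  obtain T where "T \<subseteq> X" "finite T" "X \<subseteq> (\<Union>x\<in>T. ball x e)"
    by (rule compactE_image[OF assms(1) _ cover]) auto
  then show thesis using that[of T] by (auto simp: subset_eq dist_commute)
qed

lemma return_in_nonneg_measures:
  "t \<in> X \<Longrightarrow> return (borel_on X) t \<in> nonneg_measures X"
  using prob_space_return[of t "borel_on X"]
  by (auto simp: nonneg_measures_def space_restrict_space prob_space_imp_sigma_finite
      intro: prob_space.finite_measure)

lemma measurement_operator_sum:
  assumes \<Phi>: "measurement_operator X \<Phi>" and "finite T" and mem: "\<And>t. t \<in> T \<Longrightarrow> \<mu> t \<in> signed_measures X"
  shows "\<Phi> (\<lambda>A. \<Sum>t\<in>T. w t * \<mu> t A) = (\<Sum>t\<in>T. w t *\<^sub>R \<Phi> (\<mu> t))"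
proof -
  have zero: "(\<lambda>A. 0) \<in> signed_measures X" by (simp add: signed_measures_def)
  have add: "\<And>\<mu> \<mu>'. \<mu>\<in>signed_measures X \<Longrightarrow> \<mu>'\<in>signed_measures X \<Longrightarrow> \<Phi> (\<lambda>A. \<mu> A + \<mu>' A) = \<Phi> \<mu> + \<Phi> \<mu>'"
    and scale: "\<And>\<mu> r. \<mu>\<in>signed_measures X \<Longrightarrow> \<Phi> (\<lambda>A. r * \<mu> A) = r *\<^sub>R \<Phi> \<mu>"
    using \<Phi> by (auto simp: measurement_operator_def)
  have "\<Phi> (\<lambda>A. \<Sum>t\<in>T. w t * \<mu> t A) = (\<Sum>t\<in>T. w t *\<^sub>R \<Phi> (\<mu> t)) \<and>
      (\<lambda>A. \<Sum>t\<in>T. w t * \<mu> t A) \<in> signed_measures X"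
    using \<open>finite T\<close> mem
  proof (induction rule: finite_induct)
    case empty
    show ?case using scale[OF zero, of 0] zero by simp
  next
    case (insert x F)
    then have 1: "(\<lambda>A. \<Sum>t\<in>F. w t * \<mu> t A) \<in> signed_measures X"
      and 2: "\<Phi> (\<lambda>A. \<Sum>t\<in>F. w t * \<mu> t A) = (\<Sum>t\<in>F. w t *\<^sub>R \<Phi> (\<mu> t))"
      and 3: "(\<lambda>A. w x * \<mu> x A) \<in> signed_measures X" "\<mu> x \<in> signed_measures X"
      by (auto intro: signed_measures_scale)
    show ?case
      using add[OF 3(1) 1] signed_measures_add[OF 3(1) 1] insert(1,2) 2 scale[OF 3(2), of "w x"] by simp
  qed
  then show ?thesis by blast
qed

text \<open>Rounding every point to the nearest point of a finite net turns \<open>\<nu>\<close> into a finite combination of Dirac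
  measures, on which \<open>\<Phi>\<close> is known by linearity.\<close>

lemma discretized_measure:
  fixes X :: "'a::euclidean_space set"
  assumes \<Phi>: "measurement_operator X \<Phi>" and \<nu>: "\<nu> \<in> nonneg_measures X" and X: "compact X"
    and nonempty: "X \<noteq> {}" and e: "e > 0"
  obtains \<sigma> \<nu>' where "\<And>x. x \<in> X \<Longrightarrow> \<sigma> x \<in> X \<and> dist x (\<sigma> x) < e" "\<nu>' \<in> nonneg_measures X"
    "\<And>f :: 'a \<Rightarrow> real. (\<lambda>x. f (\<sigma> x)) \<in> borel_measurable \<nu>"
    "\<And>f :: 'a \<Rightarrow> real. continuous_on X f \<Longrightarrow> (\<integral>x. f x \<partial>\<nu>') = (\<integral>x. f (\<sigma> x) \<partial>\<nu>)"
    "\<And>h. h \<bullet> \<Phi> (measure \<nu>') = (\<integral>x. h \<bullet> feature X \<Phi> (\<sigma> x) \<partial>\<nu>)"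
proof -
  interpret finite_measure \<nu> using nonneg_measuresD(1)[OF \<nu>] .
  note sp = nonneg_measuresD(2)[OF \<nu>] and st = nonneg_measuresD(3)[OF \<nu>]
  obtain T where T: "finite T" "T \<subseteq> X" "\<And>x. x \<in> X \<Longrightarrow> \<exists>t\<in>T. dist x t < e"
    using compact_finite_net[OF X e] by metis
  have Tne: "T \<noteq> {}" using nonempty T(3) by blast
  have "(\<lambda>x. - dist x t) \<in> borel_measurable (borel_on X)" for t
    by (intro measurable_restrict_space1) measurable
  then have "(\<lambda>x. - dist x t) \<in> borel_measurable \<nu>" for t
    using measurable_cong_sets[OF st refl, of borel] by blast
  then obtain \<sigma> where \<sigma>: "\<And>w. \<sigma> w \<in> T" "\<And>w t. t \<in> T \<Longrightarrow> - dist w t \<le> - dist w (\<sigma> w)"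
    "\<And>t. {w \<in> space \<nu>. \<sigma> w = t} \<in> sets \<nu>"
    by (rule finite_argmax_measurable[OF T(1) Tne, of "\<lambda>x t. - dist x t" \<nu>]) (rule that)
  have \<sigma>X: "\<sigma> x \<in> X \<and> dist x (\<sigma> x) < e" if "x \<in> X" for x
  proof -
    obtain t where t: "t \<in> T" "dist x t < e" using T(3)[OF \<open>x \<in> X\<close>] by blast
    have "dist x (\<sigma> x) \<le> dist x t" using \<sigma>(2)[OF t(1), of x] by simp
    then show ?thesis using t(2) T(2) \<sigma>(1)[of x] by auto
  qed
  define w where "w t = measure \<nu> {x \<in> space \<nu>. \<sigma> x = t}" for t
  \<comment> \<open>Functions of the rounded point are simple functions, so their integrals are finite sums.\<close>
  have exp: "g (\<sigma> x) = (\<Sum>t\<in>T. g t * indicator {x \<in> space \<nu>. \<sigma> x = t} x)"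
    if "x \<in> space \<nu>" for g :: "'a \<Rightarrow> real" and x
  proof -
    have "(\<Sum>t\<in>T. g t * indicator {x \<in> space \<nu>. \<sigma> x = t} x) = (\<Sum>t\<in>T. if t = \<sigma> x then g t else 0)"
      using that by (intro sum.cong) (auto simp: indicator_def)
    also have "\<dots> = g (\<sigma> x)" using T(1) \<sigma>(1)[of x] by simp
    finally show ?thesis by simp
  qed
  have mb: "(\<lambda>x. g (\<sigma> x)) \<in> borel_measurable \<nu>" for g :: "'a \<Rightarrow> real"
    by (subst measurable_cong[OF exp]) (use \<sigma>(3) in \<open>auto intro!: borel_measurable_sum\<close>)
  have int: "(\<integral>x. g (\<sigma> x) \<partial>\<nu>) = (\<Sum>t\<in>T. w t * g t)" for g :: "'a \<Rightarrow> real"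
  proof -
    have "(\<integral>x. g (\<sigma> x) \<partial>\<nu>) = (\<integral>x. (\<Sum>t\<in>T. g t * indicator {x \<in> space \<nu>. \<sigma> x = t} x) \<partial>\<nu>)"
      by (rule Bochner_Integration.integral_cong) (auto simp: exp)
    also have "\<dots> = (\<Sum>t\<in>T. \<integral>x. g t * indicator {x \<in> space \<nu>. \<sigma> x = t} x \<partial>\<nu>)"
      using \<sigma>(3) by (intro Bochner_Integration.integral_sum) (auto simp: emeasure_eq_measure)
    also have "\<dots> = (\<Sum>t\<in>T. w t * g t)"
      using \<sigma>(3) by (intro sum.cong) (auto simp: w_def Int_absorb1 Collect_restrict)
    finally show ?thesis .
  qed
  have \<sigma>m: "\<sigma> \<in> measurable \<nu> (borel_on X)"
  proof (rule measurableI)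
    fix A assume "A \<in> sets (borel_on X)"
    have "\<sigma> -` A \<inter> space \<nu> = (\<Union>t\<in>T \<inter> A. {x \<in> space \<nu>. \<sigma> x = t})" using \<sigma>(1) by auto
    then show "\<sigma> -` A \<inter> space \<nu> \<in> sets \<nu>" using \<sigma>(3) T(1) by (auto intro!: sets.finite_UN)
  qed (use \<sigma>X sp in \<open>auto simp: space_restrict_space\<close>)
  define \<nu>' where "\<nu>' = distr \<nu> (borel_on X) \<sigma>"
  have \<nu>': "\<nu>' \<in> nonneg_measures X"
    unfolding nonneg_measures_def \<nu>'_def using finite_measure_distr[OF \<sigma>m] by (auto simp: space_restrict_space)
  have "measure \<nu>' A = (\<Sum>t\<in>T. w t * measure (return (borel_on X) t) A)" for A
  proof (cases "A \<in> sets (borel_on X)")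
    case True
    have "measure \<nu>' A = measure \<nu> (\<sigma> -` A \<inter> space \<nu>)"
      unfolding \<nu>'_def by (rule measure_distr[OF \<sigma>m True])
    also have "\<dots> = (\<integral>x. indicator (\<sigma> -` A \<inter> space \<nu>) x \<partial>\<nu>)"
      using measurable_sets[OF \<sigma>m True] by simp
    also have "\<dots> = (\<integral>x. indicator A (\<sigma> x) \<partial>\<nu>)"
      by (rule Bochner_Integration.integral_cong) (auto simp: indicator_def)
    also have "\<dots> = (\<Sum>t\<in>T. w t * indicator A t)" by (rule int)
    finally show ?thesis using True by (simp add: measure_return)
  next
    case False
    then show ?thesis using nonneg_measuresD(3)[OF \<nu>'] by (simp add: measure_notin_sets)
  qed
  then have "\<Phi> (measure \<nu>') = \<Phi> (\<lambda>A. \<Sum>t\<in>T. w t * measure (return (borel_on X) t) A)" by presburger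
  also have "\<dots> = (\<Sum>t\<in>T. w t *\<^sub>R feature X \<Phi> t)"
    unfolding feature_def
    by (rule measurement_operator_sum[OF \<Phi> T(1)])
       (use T(2) in \<open>auto intro!: measure_in_signed_measures return_in_nonneg_measures\<close>)
  finally have "h \<bullet> \<Phi> (measure \<nu>') = (\<integral>x. h \<bullet> feature X \<Phi> (\<sigma> x) \<partial>\<nu>)" for h
    using int[of "\<lambda>t. h \<bullet> feature X \<Phi> t"] by (simp add: inner_sum_right)
  moreover have "(\<integral>x. f x \<partial>\<nu>') = (\<integral>x. f (\<sigma> x) \<partial>\<nu>)" if "continuous_on X f" for f :: "'a \<Rightarrow> real"
    unfolding \<nu>'_def by (rule integral_distr[OF \<sigma>m]) (rule borel_measurable_continuous_on_restrict[OF that])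
  ultimately show thesis using that[of \<sigma> \<nu>'] \<sigma>X \<nu>' mb by blast
qed

lemma continuous_integrable_nonneg_measure:
  fixes f :: "'a::euclidean_space \<Rightarrow> real"
  assumes \<nu>: "\<nu> \<in> nonneg_measures X" and X: "compact X" and f: "continuous_on X f"
  shows "integrable \<nu> f"
proof -
  interpret finite_measure \<nu> using nonneg_measuresD(1)[OF \<nu>] .
  note sp = nonneg_measuresD(2)[OF \<nu>] and st = nonneg_measuresD(3)[OF \<nu>]
  obtain B where B: "\<And>x. x \<in> X \<Longrightarrow> norm (f x) \<le> B"
    using compact_imp_bounded[OF compact_continuous_image[OF f X]] by (auto simp: bounded_iff)
  have "f \<in> borel_measurable \<nu>"
    using borel_measurable_continuous_on_restrict[OF f] by (simp cong: measurable_cong_sets add: st)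
  then show ?thesis
    using B sp by (intro integrable_const_bound[where B = B]) auto
qed

text \<open>The formula holds for the discretizations. Refining the net, they converge to \<open>\<nu>\<close> in the weak-* sense
  by dominated convergence, and \<open>\<Phi>\<close> is continuous from the weak-* to the weak topology.\<close>

lemma measurement_operator_eq_integral:
  fixes X :: "'a::euclidean_space set"
  assumes \<Phi>: "measurement_operator X \<Phi>" and \<nu>: "\<nu> \<in> nonneg_measures X" and X: "compact X" "X \<noteq> {}"
    and cont: "continuous_on X (feature X \<Phi>)"
  shows "h \<bullet> \<Phi> (measure \<nu>) = (\<integral>t. h \<bullet> feature X \<Phi> t \<partial>\<nu>)"
proof -
  interpret finite_measure \<nu> using nonneg_measuresD(1)[OF \<nu>] .
  note sp = nonneg_measuresD(2)[OF \<nu>] and st = nonneg_measuresD(3)[OF \<nu>]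
  define good where "good n \<sigma> \<nu>' \<longleftrightarrow>
    (\<forall>x. x \<in> X \<longrightarrow> \<sigma> x \<in> X \<and> dist x (\<sigma> x) < inverse (real (Suc n))) \<and> \<nu>' \<in> nonneg_measures X \<and>
    (\<forall>f :: 'a \<Rightarrow> real. (\<lambda>x. f (\<sigma> x)) \<in> borel_measurable \<nu>) \<and>
    (\<forall>f :: 'a \<Rightarrow> real. continuous_on X f \<longrightarrow> (\<integral>x. f x \<partial>\<nu>') = (\<integral>x. f (\<sigma> x) \<partial>\<nu>)) \<and>
    (\<forall>h. h \<bullet> \<Phi> (measure \<nu>') = (\<integral>x. h \<bullet> feature X \<Phi> (\<sigma> x) \<partial>\<nu>))" for n \<sigma> \<nu>'
  have "\<exists>\<sigma> \<nu>'. good n \<sigma> \<nu>'" for n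
  proof (rule discretized_measure[OF \<Phi> \<nu> X, of "inverse (real (Suc n))"])
    show "0 < inverse (real (Suc n))" by simp
  qed (unfold good_def, blast)
  then obtain \<sigma> \<nu>' where good: "\<And>n. good n (\<sigma> n) (\<nu>' n)" by metis
  have \<sigma>: "\<And>n x. x \<in> X \<Longrightarrow> \<sigma> n x \<in> X \<and> dist x (\<sigma> n x) < inverse (real (Suc n))"
    and \<nu>': "\<And>n. \<nu>' n \<in> nonneg_measures X"
    and mb: "\<And>n f. (\<lambda>x. f (\<sigma> n x) :: real) \<in> borel_measurable \<nu>"
    and int: "\<And>n f. continuous_on X f \<Longrightarrow> (\<integral>x. f x \<partial>\<nu>' n) = (\<integral>x. (f (\<sigma> n x) :: real) \<partial>\<nu>)"
    and eq: "\<And>n h. h \<bullet> \<Phi> (measure (\<nu>' n)) = (\<integral>x. h \<bullet> feature X \<Phi> (\<sigma> n x) \<partial>\<nu>)"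
    using good unfolding good_def by blast+
  have \<sigma>lim: "(\<lambda>n. \<sigma> n x) \<longlonglongrightarrow> x" if "x \<in> X" for x
  proof (rule metric_tendsto_imp_tendsto[OF LIMSEQ_inverse_real_of_nat])
    show "\<forall>\<^sub>F n in sequentially. dist (\<sigma> n x) x \<le> dist (inverse (real (Suc n))) 0"
      using \<sigma>[OF that] by (intro always_eventually) (auto simp: dist_commute intro: less_imp_le)
  qed
  have lim: "(\<lambda>n. \<integral>x. f (\<sigma> n x) \<partial>\<nu>) \<longlonglongrightarrow> (\<integral>x. f x \<partial>\<nu>)" if f: "continuous_on X f" for f :: "'a \<Rightarrow> real"
  proof -
    obtain B where B: "\<And>x. x \<in> X \<Longrightarrow> norm (f x) \<le> B"
      using compact_imp_bounded[OF compact_continuous_image[OF f X(1)]] by (auto simp: bounded_iff)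
    show ?thesis
    proof (rule integral_dominated_convergence[where w = "\<lambda>_. B"])
      show "f \<in> borel_measurable \<nu>"
        using continuous_integrable_nonneg_measure[OF \<nu> X(1) f] by simp
      show "AE x in \<nu>. (\<lambda>n. f (\<sigma> n x)) \<longlonglongrightarrow> f x"
        using \<sigma> sp by (auto intro!: continuous_on_tendsto_compose[OF f \<sigma>lim] AE_I2)
      show "\<And>n. AE x in \<nu>. norm (f (\<sigma> n x)) \<le> B" using B \<sigma> sp by (auto intro!: AE_I2)
    qed (use mb in auto)
  qed
  have "(\<lambda>n. h \<bullet> \<Phi> (measure (\<nu>' n))) \<longlonglongrightarrow> h \<bullet> \<Phi> (measure \<nu>)"
  proof (rule measurement_operator_tendsto[OF \<Phi>])
    fix f :: "'a \<Rightarrow> real" assume f: "continuous_on X f"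
    show "(\<lambda>n. signed_integral X (measure (\<nu>' n)) f) \<longlonglongrightarrow> signed_integral X (measure \<nu>) f"
      using lim[OF f] by (simp add: signed_integral_measure \<nu> \<nu>' int[OF f])
  qed (use \<nu> \<nu>' in \<open>auto intro: measure_in_signed_measures\<close>)
  moreover have "(\<lambda>n. h \<bullet> \<Phi> (measure (\<nu>' n))) \<longlonglongrightarrow> (\<integral>t. h \<bullet> feature X \<Phi> t \<partial>\<nu>)"
    unfolding eq by (rule lim) (intro continuous_intros cont)
  ultimately show ?thesis by (rule LIMSEQ_unique)
qed

section \<open>Second differences, volumes of balls, and random measures\<close>

text \<open>The expression is the increment from \<open>t\<close> to \<open>s\<close> of the function \<open>x \<mapsto> k(x, s) - k(x, t)\<close>. Its derivative is
  itself a difference of two values of the derivative of \<open>k\<close>, which is Lipschitz, so the factor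
  \<open>norm (s - t)\<close> appears twice.\<close>

lemma C2_on_second_difference_bound:
  fixes k :: "'a::euclidean_space \<times> 'a \<Rightarrow> real"
  assumes X: "compact X" "convex X" and k: "C2_on (X \<times> X) k"
  obtains B where "B \<ge> 0"
    "\<And>s t. s \<in> X \<Longrightarrow> t \<in> X \<Longrightarrow> \<bar>(k (s, s) - k (s, t)) - (k (t, s) - k (t, t))\<bar> \<le> B * (norm (s - t))\<^sup>2"
proof -
  obtain f' :: "'a \<times> 'a \<Rightarrow> ('a \<times> 'a) \<Rightarrow>\<^sub>L real" and f'' :: "'a \<times> 'a \<Rightarrow> ('a \<times> 'a) \<Rightarrow>\<^sub>L (('a \<times> 'a) \<Rightarrow>\<^sub>L real)"
    where d1: "\<And>x. x \<in> X \<times> X \<Longrightarrow> (k has_derivative blinfun_apply (f' x)) (at x within X \<times> X)"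
      and d2: "\<And>x. x \<in> X \<times> X \<Longrightarrow> (f' has_derivative blinfun_apply (f'' x)) (at x within X \<times> X)"
      and c2: "continuous_on (X \<times> X) f''"
    using k unfolding C2_on_def by blast
  have "bounded (f'' ` (X \<times> X))"
    by (intro compact_imp_bounded compact_continuous_image c2 compact_Times X)
  then obtain B0 where B0: "\<And>x. x \<in> X \<times> X \<Longrightarrow> norm (f'' x) \<le> B0" by (auto simp: bounded_iff)
  define B where "B = max 0 B0"
  have B: "\<And>x. x \<in> X \<times> X \<Longrightarrow> norm (f'' x) \<le> B" and B_nonneg: "B \<ge> 0"
    using B0 unfolding B_def by fastforce+
  have lip: "norm (f' p - f' q) \<le> B * norm (p - q)" if "p \<in> X \<times> X" "q \<in> X \<times> X" for p q
    by (rule differentiable_bound[OF _ d2])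
       (use that X B in \<open>auto simp: convex_Times simp flip: norm_blinfun.rep_eq\<close>)
  have "\<bar>(k (s, s) - k (s, t)) - (k (t, s) - k (t, t))\<bar> \<le> B * (norm (s - t))\<^sup>2"
    if st: "s \<in> X" "t \<in> X" for s t
  proof -
    have der: "((\<lambda>x. k (x, u)) has_derivative (\<lambda>h. f' (x, u) (h, 0))) (at x within X)"
      if "x \<in> X" "u \<in> X" for x u
    proof -
      have "(k has_derivative blinfun_apply (f' (x, u))) (at (x, u) within (\<lambda>x. (x, u)) ` X)"
        by (rule has_derivative_subset[OF d1]) (use that in auto)
      moreover have "((\<lambda>x. (x, u)) has_derivative (\<lambda>h. (h, 0))) (at x within X)"
        by (intro has_derivative_Pair has_derivative_ident has_derivative_const)
      ultimately show ?thesis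
        using has_derivative_in_compose[of "\<lambda>x. (x, u)" "\<lambda>h. (h, 0)" x X k "blinfun_apply (f' (x, u))"] by simp
    qed
    have "norm ((k (s, s) - k (s, t)) - (k (t, s) - k (t, t))) \<le> (B * norm (s - t)) * norm (s - t)"
    proof (rule differentiable_bound[OF X(2), where f = "\<lambda>x. k (x, s) - k (x, t)"])
      show "((\<lambda>x. k (x, s) - k (x, t)) has_derivative (\<lambda>h. f' (x, s) (h, 0) - f' (x, t) (h, 0))) (at x within X)"
        if "x \<in> X" for x using that st by (intro has_derivative_diff der)
      show "onorm (\<lambda>h. f' (x, s) (h, 0) - f' (x, t) (h, 0)) \<le> B * norm (s - t)" if "x \<in> X" for x
      proof (rule onorm_bound)
        fix h
        have "norm (f' (x, s) (h, 0) - f' (x, t) (h, 0)) = norm ((f' (x, s) - f' (x, t)) (h, 0))"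
          by (simp add: blinfun.diff_left)
        also have "\<dots> \<le> norm (f' (x, s) - f' (x, t)) * norm (h, 0 :: 'a)" by (rule norm_blinfun)
        also have "\<dots> \<le> (B * norm ((x, s) - (x, t))) * norm h"
          using lip[of "(x, s)" "(x, t)"] that st by (intro mult_mono) (auto simp: B_nonneg norm_Pair)
        finally show "norm (f' (x, s) (h, 0) - f' (x, t) (h, 0)) \<le> B * norm (s - t) * norm h"
          by (simp add: norm_Pair)
      qed (use B_nonneg in auto)
    qed (use st in auto)
    then show ?thesis by (simp add: power2_eq_square mult.assoc)
  qed
  with B_nonneg that show thesis by blast
qed

text \<open>Shrinking an interior ball of \<open>X\<close> towards \<open>t\<close> by the factor \<open>r / D\<close>, where \<open>D\<close> bounds the diameter, gives a
  ball that convexity keeps inside \<open>X\<close> and that lies within distance \<open>r\<close> of \<open>t\<close>. This covers boundary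
  points \<open>t\<close> as well.\<close>

lemma convex_cball_volume:
  fixes X :: "'a::euclidean_space set"
  assumes X: "compact X" "convex X" "interior X \<noteq> {}"
  obtains v where "v > 0"
    "\<And>t r. t \<in> X \<Longrightarrow> 0 < r \<Longrightarrow> r \<le> 1 \<Longrightarrow> v * r ^ DIM('a) \<le> measure lborel (X \<inter> cball t r)"
proof -
  obtain x0 where "x0 \<in> interior X" using X by blast
  then obtain \<rho> where \<rho>: "\<rho> > 0" "ball x0 \<rho> \<subseteq> X" unfolding mem_interior by blast
  obtain D0 where D0: "\<And>x. x \<in> X \<Longrightarrow> norm x \<le> D0" using compact_imp_bounded[OF X(1)] by (auto simp: bounded_iff)
  define D where "D = max 1 (2 * D0)"
  have D: "dist x t \<le> D" if "x \<in> X" "t \<in> X" for x t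
    using norm_triangle_ineq4[of x t] D0[OF that(1)] D0[OF that(2)] by (auto simp: D_def dist_norm)
  have D1: "D \<ge> 1" by (simp add: D_def)
  define v where "v = unit_ball_vol DIM('a) * (\<rho> / D) ^ DIM('a)"
  have "v * r ^ DIM('a) \<le> measure lborel (X \<inter> cball t r)" if t: "t \<in> X" and r: "0 < r" "r \<le> 1" for t r
  proof -
    define s where "s = r / D"
    have s: "0 < s" "s \<le> 1" using r D1 by (auto simp: s_def divide_simps)
    let ?c = "(1 - s) *\<^sub>R t + s *\<^sub>R x0"
    have "ball ?c (s * \<rho>) \<subseteq> X \<inter> cball t r"
    proof
      fix z assume z: "z \<in> ball ?c (s * \<rho>)"
      define x where "x = x0 + (1 / s) *\<^sub>R (z - ?c)"
      have zx: "z = (1 - s) *\<^sub>R t + s *\<^sub>R x" using s by (simp add: x_def algebra_simps)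
      have "norm (x - x0) = norm (z - ?c) / s" using s by (simp add: x_def)
      also have "\<dots> < \<rho>" using z s by (simp add: dist_norm norm_minus_commute divide_simps mult.commute)
      finally have xX: "x \<in> X" using \<rho>(2) by (auto simp: dist_norm norm_minus_commute)
      then have "z \<in> X" unfolding zx using X(2) t s by (intro convexD) auto
      moreover have "dist t z = s * dist x t"
      proof -
        have "z - t = s *\<^sub>R (x - t)" by (simp add: zx algebra_simps)
        then show ?thesis using s by (subst dist_commute) (simp add: dist_norm)
      qed
      moreover have "s * dist x t \<le> r"
      proof -
        have "s * dist x t \<le> s * D" using D[OF xX t] s by (intro mult_left_mono) auto
        then show ?thesis using D1 by (simp add: s_def)
      qed
      ultimately show "z \<in> X \<inter> cball t r" by simp
    qed
    then have "measure lborel (ball ?c (s * \<rho>)) \<le> measure lborel (X \<inter> cball t r)"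
      by (intro measure_mono_fmeasurable fmeasurable_compact compact_Int X compact_cball) auto
    moreover have "measure lborel (ball ?c (s * \<rho>)) = unit_ball_vol DIM('a) * (s * \<rho>) ^ DIM('a)"
      using s \<rho>(1) by (intro content_ball) simp
    moreover have "unit_ball_vol DIM('a) * (s * \<rho>) ^ DIM('a) = v * r ^ DIM('a)"
      by (simp add: v_def s_def power_mult_distrib power_divide)
    ultimately show ?thesis by simp
  qed
  moreover have "v > 0" using \<rho>(1) D1 by (simp add: v_def)
  ultimately show thesis using that by blast
qed

text \<open>The squared norm is a countable supremum of scalar functions:
  \<open>\<parallel>v\<parallel>\<^sup>2 = sup\<^sub>h (2 (h \<bullet> v) - \<parallel>h\<parallel>\<^sup>2)\<close> over a countable dense set of \<open>h\<close>.\<close>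

lemma norm_sq_measurable_of_inner:
  fixes V :: "'w \<Rightarrow> 'h::{real_inner, second_countable_topology}"
  assumes m: "\<And>h. (\<lambda>w. h \<bullet> V w) \<in> borel_measurable N"
  shows "(\<lambda>w. (norm (V w))\<^sup>2) \<in> borel_measurable N"
proof -
  obtain D :: "'h set" where D: "countable D" "\<And>U. open U \<Longrightarrow> U \<noteq> {} \<Longrightarrow> \<exists>d\<in>D. d \<in> U"
    using countable_dense_exists by blast
  have key: "(norm v)\<^sup>2 \<le> a \<longleftrightarrow> (\<forall>h\<in>D. 2 * (h \<bullet> v) - (norm h)\<^sup>2 \<le> a)" for v :: 'h and a
  proof
    assume a: "(norm v)\<^sup>2 \<le> a"
    show "\<forall>h\<in>D. 2 * (h \<bullet> v) - (norm h)\<^sup>2 \<le> a"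
    proof
      fix h
      have "0 \<le> (norm (v - h))\<^sup>2" by simp
      also have "\<dots> = (norm v)\<^sup>2 - 2 * (h \<bullet> v) + (norm h)\<^sup>2"
        by (simp add: power2_norm_eq_inner algebra_simps inner_commute)
      finally show "2 * (h \<bullet> v) - (norm h)\<^sup>2 \<le> a" using a by simp
    qed
  next
    assume *: "\<forall>h\<in>D. 2 * (h \<bullet> v) - (norm h)\<^sup>2 \<le> a"
    show "(norm v)\<^sup>2 \<le> a"
    proof (rule field_le_epsilon)
      fix e :: real assume e: "e > 0"
      obtain h where h: "h \<in> D" "h \<in> ball v (sqrt e)" using D(2)[of "ball v (sqrt e)"] e by auto
      have "(norm (v - h))\<^sup>2 \<le> (sqrt e)\<^sup>2" using h(2) by (intro power_mono) (auto simp: dist_norm)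
      moreover have "(norm (v - h))\<^sup>2 = (norm v)\<^sup>2 - 2 * (h \<bullet> v) + (norm h)\<^sup>2"
        by (simp add: power2_norm_eq_inner algebra_simps inner_commute)
      moreover have "2 * (h \<bullet> v) - (norm h)\<^sup>2 \<le> a" using * h(1) by blast
      ultimately show "(norm v)\<^sup>2 \<le> a + e" using e by simp
    qed
  qed
  show ?thesis
    unfolding borel_measurable_iff_le
  proof
    fix a
    have "{w \<in> space N. (norm (V w))\<^sup>2 \<le> a} = {w \<in> space N. \<forall>h\<in>D. 2 * (h \<bullet> V w) - (norm h)\<^sup>2 \<le> a}"
      using key by blast
    also have "\<dots> \<in> sets N"
      using m by (intro sets.sets_Collect_countable_All'[OF _ D(1)] borel_measurable_le) auto
    finally show "{w \<in> space N. (norm (V w))\<^sup>2 \<le> a} \<in> sets N" .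
  qed
qed

text \<open>Measurability of the evaluations on sets extends to integrals by the usual induction from indicators
  to limits of simple functions.\<close>

lemma nn_integral_random_measure_measurable:
  assumes \<nu>: "\<And>w. w \<in> space N \<Longrightarrow> \<nu> w \<in> nonneg_measures X"
    and m: "\<And>B. B \<in> sets (borel_on X) \<Longrightarrow> (\<lambda>w. measure (\<nu> w) B) \<in> borel_measurable N"
    and f: "f \<in> borel_measurable (borel_on X)"
  shows "(\<lambda>w. \<integral>\<^sup>+ t. f t \<partial>\<nu> w) \<in> borel_measurable N"
proof -
  have meas: "g \<in> borel_measurable (\<nu> w)"
    if "g \<in> borel_measurable (borel_on X)" "w \<in> space N" for g :: "_ \<Rightarrow> ennreal" and w
    using that(1) measurable_cong_sets[OF nonneg_measuresD(3)[OF \<nu>[OF that(2)]] refl, of "borel :: ennreal measure"] by (simp only:)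
  show ?thesis using f
  proof (induction rule: borel_measurable_induct)
    case (cong f g)
    have "(\<integral>\<^sup>+ t. f t \<partial>\<nu> w) = (\<integral>\<^sup>+ t. g t \<partial>\<nu> w)" if "w \<in> space N" for w
      using nonneg_measuresD(2)[OF \<nu>[OF that]] cong(3)
      by (intro nn_integral_cong) (auto simp: space_restrict_space)
    then show ?case using cong(4) by (simp cong: measurable_cong)
  next
    case (set A)
    have "(\<integral>\<^sup>+ t. indicator A t \<partial>\<nu> w) = ennreal (measure (\<nu> w) A)" if "w \<in> space N" for w
      using nonneg_measuresD[OF \<nu>[OF that]] set by (simp add: finite_measure.emeasure_eq_measure)
    then show ?case using m[OF set] by (simp cong: measurable_cong)
  next
    case (mult u c)
    have "(\<integral>\<^sup>+ t. c * u t \<partial>\<nu> w) = c * (\<integral>\<^sup>+ t. u t \<partial>\<nu> w)" if "w \<in> space N" for w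
      by (rule nn_integral_cmult[OF meas[OF mult(2) that]])
    then show ?case using mult(4) by (simp cong: measurable_cong)
  next
    case (add u v)
    have "(\<integral>\<^sup>+ t. v t + u t \<partial>\<nu> w) = (\<integral>\<^sup>+ t. v t \<partial>\<nu> w) + (\<integral>\<^sup>+ t. u t \<partial>\<nu> w)" if "w \<in> space N" for w
      by (rule nn_integral_add[OF meas[OF add(3) that] meas[OF add(1) that]])
    then show ?case using add(6,7) by (simp cong: measurable_cong)
  next
    case (seq U)
    have "(\<integral>\<^sup>+ t. (SUP i. U i) t \<partial>\<nu> w) = (SUP i. \<integral>\<^sup>+ t. U i t \<partial>\<nu> w)" if "w \<in> space N" for w
      unfolding SUP_apply
      by (rule nn_integral_monotone_convergence_SUP[OF seq(3) meas[OF seq(1) that]])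
    then show ?case using seq(5) by (simp cong: measurable_cong)
  qed
qed

lemma integral_random_measure_measurable:
  fixes f :: "'a::euclidean_space \<Rightarrow> real"
  assumes \<nu>: "\<And>w. w \<in> space N \<Longrightarrow> \<nu> w \<in> nonneg_measures X"
    and m: "\<And>B. B \<in> sets (borel_on X) \<Longrightarrow> (\<lambda>w. measure (\<nu> w) B) \<in> borel_measurable N"
    and X: "compact X" and f: "continuous_on X f"
  shows "(\<lambda>w. \<integral>t. f t \<partial>\<nu> w) \<in> borel_measurable N"
proof -
  have fm: "f \<in> borel_measurable (borel_on X)" by (rule borel_measurable_continuous_on_restrict[OF f])
  have "(\<integral>t. f t \<partial>\<nu> w) = enn2real (\<integral>\<^sup>+ t. ennreal (f t) \<partial>\<nu> w) - enn2real (\<integral>\<^sup>+ t. ennreal (- f t) \<partial>\<nu> w)"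
    if "w \<in> space N" for w
    by (rule real_lebesgue_integral_def[OF continuous_integrable_nonneg_measure[OF \<nu>[OF that] X f]])
  moreover have "(\<lambda>w. \<integral>\<^sup>+ t. ennreal (f t) \<partial>\<nu> w) \<in> borel_measurable N"
    using fm by (intro nn_integral_random_measure_measurable[of N \<nu> X] \<nu> m) simp_all
  moreover have "(\<lambda>w. \<integral>\<^sup>+ t. ennreal (- f t) \<partial>\<nu> w) \<in> borel_measurable N"
    using fm by (intro nn_integral_random_measure_measurable[of N \<nu> X] \<nu> m) simp_all
  ultimately show ?thesis by (simp cong: measurable_cong)
qed

section \<open>Regularity and convexity of the objective\<close>

locale kernel_problem =
  fixes X :: "'a::euclidean_space set"
    and \<Phi> :: "('a set \<Rightarrow> real) \<Rightarrow> 'h::{real_inner, banach, second_countable_topology}"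
    and y :: 'h and \<kappa> cP CP :: real
  assumes domain: "domain_ok X" and nonempty: "X \<noteq> {}"
    and operator: "measurement_operator X \<Phi>"
    and \<kappa>_pos: "\<kappa> > 0"
    and problem: "problem_assumption X \<Phi> y cP CP"
begin

abbreviation \<phi> where "\<phi> \<equiv> feature X \<Phi>"
abbreviation J where "J \<equiv> objective X \<Phi> y \<kappa>"
abbreviation J' where "J' \<equiv> objective' X \<Phi> y \<kappa>"

lemma X_compact: "compact X" and X_convex: "convex X"
  using domain by (auto simp: domain_ok_def)

lemma norm_y: "norm y \<le> CP" and CP_pos: "CP > 0"
  using problem by (auto simp: problem_assumption_def)

lemma norm_feature: "t \<in> X \<Longrightarrow> norm (\<phi> t) = 1"
  using problem by (simp add: problem_assumption_def kern_def norm_eq_sqrt_inner)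

text \<open>\<open>\<parallel>\<phi>\<^sub>s - \<phi>\<^sub>t\<parallel>\<^sup>2\<close> is the second difference of the kernel on the square with corners \<open>s\<close> and \<open>t\<close>.\<close>

lemma feature_lipschitz:
  obtains L where "L \<ge> 0" "\<And>s t. s \<in> X \<Longrightarrow> t \<in> X \<Longrightarrow> norm (\<phi> s - \<phi> t) \<le> L * norm (s - t)"
proof -
  have "C2_on (X \<times> X) (\<lambda>(s, t). kern X \<Phi> s t)" using problem by (simp add: problem_assumption_def)
  then obtain B where B: "B \<ge> 0" "\<And>s t. s \<in> X \<Longrightarrow> t \<in> X \<Longrightarrow>
      \<bar>(kern X \<Phi> s s - kern X \<Phi> s t) - (kern X \<Phi> t s - kern X \<Phi> t t)\<bar> \<le> B * (norm (s - t))\<^sup>2"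
    by (rule C2_on_second_difference_bound[OF X_compact X_convex]) (rule that, simp_all)
  have "norm (\<phi> s - \<phi> t) \<le> sqrt B * norm (s - t)" if "s \<in> X" "t \<in> X" for s t
  proof (rule power2_le_imp_le)
    have "(norm (\<phi> s - \<phi> t))\<^sup>2 = (kern X \<Phi> s s - kern X \<Phi> s t) - (kern X \<Phi> t s - kern X \<Phi> t t)"
      by (simp add: power2_norm_eq_inner kern_def algebra_simps)
    also have "\<dots> \<le> B * (norm (s - t))\<^sup>2" using B(2)[OF that] by simp
    finally show "(norm (\<phi> s - \<phi> t))\<^sup>2 \<le> (sqrt B * norm (s - t))\<^sup>2"
      using B(1) by (simp add: power_mult_distrib)
  qed (use B(1) in auto)
  then show thesis using that[of "sqrt B"] B(1) by auto
qed

lemma feature_continuous: "continuous_on X \<phi>"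
proof -
  obtain L where L: "L \<ge> 0" "\<And>s t. s \<in> X \<Longrightarrow> t \<in> X \<Longrightarrow> norm (\<phi> s - \<phi> t) \<le> L * norm (s - t)"
    by (rule feature_lipschitz) (rule that)
  then have "L-lipschitz_on X \<phi>" by (intro lipschitz_onI) (auto simp: dist_norm)
  then show ?thesis by (rule lipschitz_on_continuous_on)
qed

lemma inner_operator: "\<nu> \<in> nonneg_measures X \<Longrightarrow> h \<bullet> \<Phi> (measure \<nu>) = (\<integral>t. h \<bullet> \<phi> t \<partial>\<nu>)"
  by (rule measurement_operator_eq_integral[OF operator _ X_compact nonempty feature_continuous])

lemma objective_eq:
  "\<nu> \<in> nonneg_measures X \<Longrightarrow> J \<nu> = 1 / 2 * (norm (\<Phi> (measure \<nu>) - y))\<^sup>2 + \<kappa> * measure \<nu> X"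
  by (simp add: objective_def tv_norm_measure norm_minus_commute)

text \<open>Testing the integral representation with \<open>h = \<Phi> \<nu>\<close> gives \<open>\<parallel>\<Phi> \<nu>\<parallel>\<^sup>2 \<le> \<parallel>\<Phi> \<nu>\<parallel> \<nu>(X)\<close>, since the features are
  unit vectors.\<close>

lemma norm_operator_le:
  assumes \<nu>: "\<nu> \<in> nonneg_measures X"
  shows "norm (\<Phi> (measure \<nu>)) \<le> measure \<nu> X"
proof -
  interpret finite_measure \<nu> using nonneg_measuresD(1)[OF \<nu>] .
  let ?v = "\<Phi> (measure \<nu>)"
  have "norm ?v * norm ?v = (\<integral>t. ?v \<bullet> \<phi> t \<partial>\<nu>)"
    using inner_operator[OF \<nu>, of ?v] by (simp flip: power2_norm_eq_inner add: power2_eq_square)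
  also have "\<dots> \<le> (\<integral>t. norm ?v \<partial>\<nu>)"
  proof (rule integral_mono)
    show "integrable \<nu> (\<lambda>t. ?v \<bullet> \<phi> t)"
      by (intro continuous_integrable_nonneg_measure[OF \<nu> X_compact] continuous_intros feature_continuous)
    show "?v \<bullet> \<phi> t \<le> norm ?v" if "t \<in> space \<nu>" for t
      using norm_cauchy_schwarz[of ?v "\<phi> t"] norm_feature[of t] that nonneg_measuresD(2)[OF \<nu>] by simp
  qed simp
  also have "\<dots> = measure \<nu> X * norm ?v" using nonneg_measuresD(2)[OF \<nu>] by simp
  finally show ?thesis by (cases "norm ?v = 0") auto
qed

lemma norm_residual_le:
  "\<nu> \<in> nonneg_measures X \<Longrightarrow> norm (\<Phi> (measure \<nu>) - y) \<le> measure \<nu> X + CP"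
  using norm_operator_le[of \<nu>] norm_y norm_triangle_ineq4[of "\<Phi> (measure \<nu>)" y] by linarith

lemma objective_bounds:
  assumes \<nu>: "\<nu> \<in> nonneg_measures X" and "measure \<nu> X \<le> m"
  shows "0 \<le> J \<nu>" "J \<nu> \<le> 1 / 2 * (m + CP)\<^sup>2 + \<kappa> * m"
proof -
  show "0 \<le> J \<nu>" using \<kappa>_pos by (simp add: objective_eq[OF \<nu>])
  have "norm (\<Phi> (measure \<nu>) - y) \<le> m + CP" using norm_residual_le[OF \<nu>] assms(2) by linarith
  then have "(norm (\<Phi> (measure \<nu>) - y))\<^sup>2 \<le> (m + CP)\<^sup>2" by (intro power_mono) auto
  moreover have "\<kappa> * measure \<nu> X \<le> \<kappa> * m" using assms(2) \<kappa>_pos by simp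
  ultimately show "J \<nu> \<le> 1 / 2 * (m + CP)\<^sup>2 + \<kappa> * m" by (simp add: objective_eq[OF \<nu>])
qed

lemma objective'_bound:
  assumes "\<nu> \<in> nonneg_measures X" "t \<in> X"
  shows "\<bar>J' \<nu> t\<bar> \<le> measure \<nu> X + CP + \<kappa>"
proof -
  have "\<bar>\<phi> t \<bullet> (\<Phi> (measure \<nu>) - y)\<bar> \<le> norm (\<phi> t) * norm (\<Phi> (measure \<nu>) - y)" by (rule Cauchy_Schwarz_ineq2)
  also have "\<dots> \<le> measure \<nu> X + CP" using norm_residual_le[OF assms(1)] norm_feature[OF assms(2)] by simp
  finally show ?thesis using \<kappa>_pos unfolding objective'_def by linarith
qed

lemma objective'_continuous: "continuous_on X (J' \<nu>)"
  unfolding objective'_def by (intro continuous_intros feature_continuous)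

lemma objective'_lipschitz:
  obtains L where "L \<ge> 0" "\<And>\<nu> s t. \<nu> \<in> nonneg_measures X \<Longrightarrow> s \<in> X \<Longrightarrow> t \<in> X \<Longrightarrow>
      \<bar>J' \<nu> s - J' \<nu> t\<bar> \<le> L * (measure \<nu> X + CP) * dist s t"
proof -
  obtain L where L: "L \<ge> 0" "\<And>s t. s \<in> X \<Longrightarrow> t \<in> X \<Longrightarrow> norm (\<phi> s - \<phi> t) \<le> L * norm (s - t)"
    by (rule feature_lipschitz) (rule that)
  have "\<bar>J' \<nu> s - J' \<nu> t\<bar> \<le> L * (measure \<nu> X + CP) * dist s t"
    if "\<nu> \<in> nonneg_measures X" "s \<in> X" "t \<in> X" for \<nu> s t
  proof -
    have "J' \<nu> s - J' \<nu> t = (\<phi> s - \<phi> t) \<bullet> (\<Phi> (measure \<nu>) - y)"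
      by (simp add: objective'_def inner_diff_left)
    then have "\<bar>J' \<nu> s - J' \<nu> t\<bar> \<le> norm (\<phi> s - \<phi> t) * norm (\<Phi> (measure \<nu>) - y)"
      by (simp add: Cauchy_Schwarz_ineq2)
    also have "\<dots> \<le> (L * norm (s - t)) * (measure \<nu> X + CP)"
      by (intro mult_mono L norm_residual_le that) (use L in auto)
    finally show ?thesis by (simp add: dist_norm mult_ac)
  qed
  with L(1) show thesis using that by blast
qed

text \<open>The right-hand side is the derivative of the objective at \<open>\<nu>\<close> in direction \<open>\<nu> - \<mu>\<close>, so this is the
  subgradient inequality; the difference of the two sides is half the squared distance of the residuals.\<close>

lemma objective_convex_gap:
  assumes \<nu>: "\<nu> \<in> nonneg_measures X" and \<mu>: "\<mu> \<in> nonneg_measures X"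
  shows "J \<nu> - J \<mu> \<le> (\<integral>t. J' \<nu> t \<partial>\<nu>) - (\<integral>t. J' \<nu> t \<partial>\<mu>)"
proof -
  let ?u = "\<Phi> (measure \<nu>) - y" and ?w = "\<Phi> (measure \<mu>) - y"
  have int: "(\<integral>t. J' \<nu> t \<partial>\<eta>) = ?u \<bullet> \<Phi> (measure \<eta>) + \<kappa> * measure \<eta> X" if \<eta>: "\<eta> \<in> nonneg_measures X" for \<eta>
  proof -
    interpret finite_measure \<eta> using nonneg_measuresD(1)[OF \<eta>] .
    have "integrable \<eta> (\<lambda>t. ?u \<bullet> \<phi> t)"
      by (intro continuous_integrable_nonneg_measure[OF \<eta> X_compact] continuous_intros feature_continuous)
    then show ?thesis
      unfolding objective'_def using inner_operator[OF \<eta>, of ?u] nonneg_measuresD(2)[OF \<eta>]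
      by (simp add: inner_commute mult.commute)
  qed
  have "0 \<le> (norm (?u - ?w))\<^sup>2" by simp
  then have "1 / 2 * (norm ?u)\<^sup>2 - 1 / 2 * (norm ?w)\<^sup>2 \<le> ?u \<bullet> (?u - ?w)"
    unfolding power2_norm_eq_inner by (simp add: inner_commute algebra_simps)
  also have "\<dots> = ?u \<bullet> \<Phi> (measure \<nu>) - ?u \<bullet> \<Phi> (measure \<mu>)" by (simp add: inner_diff_right)
  finally show ?thesis unfolding int[OF \<nu>] int[OF \<mu>] by (simp add: objective_eq \<nu> \<mu> algebra_simps)
qed

lemma
  assumes \<nu>: "\<And>w. w \<in> space N \<Longrightarrow> \<nu> w \<in> nonneg_measures X"
    and m: "\<And>B. B \<in> sets (borel_on X) \<Longrightarrow> (\<lambda>w. measure (\<nu> w) B) \<in> borel_measurable N"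
  shows objective'_measurable: "(\<lambda>w. J' (\<nu> w) t) \<in> borel_measurable N"
    and objective_measurable: "(\<lambda>w. J (\<nu> w)) \<in> borel_measurable N"
proof -
  have inner: "(\<lambda>w. h \<bullet> (\<Phi> (measure (\<nu> w)) - y)) \<in> borel_measurable N" for h
  proof -
    have "(\<lambda>w. (\<integral>t. h \<bullet> \<phi> t \<partial>\<nu> w) - h \<bullet> y) \<in> borel_measurable N"
      by (intro borel_measurable_diff borel_measurable_const
          integral_random_measure_measurable[OF \<nu> m X_compact] continuous_intros feature_continuous)
    then show ?thesis by (simp add: inner_diff_right inner_operator[OF \<nu>] cong: measurable_cong)
  qed
  then show "(\<lambda>w. J' (\<nu> w) t) \<in> borel_measurable N" unfolding objective'_def by simp
  have "X \<in> sets (borel_on X)" using sets.top[of "borel_on X"] by (simp add: space_restrict_space)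
  then have "(\<lambda>w. 1 / 2 * (norm (\<Phi> (measure (\<nu> w)) - y))\<^sup>2 + \<kappa> * measure (\<nu> w) X) \<in> borel_measurable N"
    by (intro borel_measurable_add borel_measurable_times borel_measurable_const norm_sq_measurable_of_inner inner m)
  then show "(\<lambda>w. J (\<nu> w)) \<in> borel_measurable N"
    by (simp add: objective_eq[OF \<nu>] cong: measurable_cong)
qed

end

section \<open>Exploration turns a dip of the first variation into gradient norm\<close>

text \<open>A conditional lower bound for each fixed index \<open>t\<close> yields one for the randomly selected index \<open>\<sigma>\<close>: the
  events \<open>\<sigma> = t\<close> are known given \<open>N\<close>, so the conditional expectations can be
  integrated against \<open>w\<close> on each of them and added up.\<close>

lemma (in prob_space) expectation_selected_ge:
  fixes g :: "'b \<Rightarrow> 'a \<Rightarrow> real"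
  assumes sub: "subalgebra M N" and T: "finite T" and \<sigma>: "\<And>\<omega>. \<sigma> \<omega> \<in> T"
    "\<And>t. {\<omega> \<in> space N. \<sigma> \<omega> = t} \<in> sets N"
    and w: "w \<in> borel_measurable N" "\<And>\<omega>. 0 \<le> w \<omega>" "AE \<omega> in M. w \<omega> \<le> W"
    and g: "\<And>t. t \<in> T \<Longrightarrow> g t \<in> borel_measurable M" "\<And>t \<omega>. 0 \<le> g t \<omega>"
      "\<And>t. t \<in> T \<Longrightarrow> AE \<omega> in M. g t \<omega> \<le> m"
    and lower: "\<And>t. t \<in> T \<Longrightarrow> AE \<omega> in M. \<sigma> \<omega> = t \<longrightarrow> 0 < w \<omega> \<longrightarrow> b \<le> real_cond_exp M N (g t) \<omega>"
    and H: "integrable M H" "AE \<omega> in M. w \<omega> * g (\<sigma> \<omega>) \<omega> \<le> H \<omega>"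
  shows "b * expectation w \<le> expectation H"
proof -
  interpret finite_measure_subalgebra M N by standard (rule sub)
  have spN: "space N = space M" using sub by (simp add: subalgebra_def)
  have wM: "w \<in> borel_measurable M" by (rule measurable_from_subalg[OF sub w(1)])
  define f where "f t \<omega> = w \<omega> * indicator {\<omega> \<in> space N. \<sigma> \<omega> = t} \<omega>" for t \<omega>
  have fN: "f t \<in> borel_measurable N" for t unfolding f_def using w(1) \<sigma>(2) by measurable
  have fM: "f t \<in> borel_measurable M" for t by (rule measurable_from_subalg[OF sub fN])
  have f0: "0 \<le> f t \<omega>" for t \<omega> using w(2) by (simp add: f_def)
  have fW: "AE \<omega> in M. f t \<omega> \<le> W" for t
    using w(3)
  proof eventually_elim
    case (elim \<omega>)
    then show ?case using w(2)[of \<omega>] by (auto simp: f_def indicator_def)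
  qed
  have f_int: "integrable M (f t)" for t
    by (rule integrable_const_bound[where B = W]) (use fW f0 fM in auto)
  have w_int: "integrable M w"
    by (rule integrable_const_bound[where B = W]) (use w wM in auto)
  have fg_int: "integrable M (\<lambda>\<omega>. f t \<omega> * g t \<omega>)" if "t \<in> T" for t
  proof (rule integrable_const_bound[where B = "W * m"])
    show "AE \<omega> in M. norm (f t \<omega> * g t \<omega>) \<le> W * m"
      using fW[of t] g(3)[OF that]
    proof eventually_elim
      case (elim \<omega>)
      have "f t \<omega> * g t \<omega> \<le> W * m"
        by (rule mult_mono) (use elim f0[of t \<omega>] g(2)[of t \<omega>] in auto)
      then show ?case using f0[of t \<omega>] g(2)[of t \<omega>] by simp
    qed
  qed (use fM g(1)[OF that] in measurable)
  have split: "(\<Sum>t\<in>T. f t \<omega> * h t) = w \<omega> * h (\<sigma> \<omega>)" if "\<omega> \<in> space M" for h :: "'b \<Rightarrow> real" and \<omega>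
  proof -
    have "(\<Sum>t\<in>T. f t \<omega> * h t) = (\<Sum>t\<in>T. if t = \<sigma> \<omega> then w \<omega> * h t else 0)"
      using that by (intro sum.cong) (auto simp: f_def spN)
    also have "\<dots> = w \<omega> * h (\<sigma> \<omega>)" using T \<sigma>(1)[of \<omega>] by simp
    finally show ?thesis .
  qed
  have piece: "b * expectation (f t) \<le> expectation (\<lambda>\<omega>. f t \<omega> * g t \<omega>)" if t: "t \<in> T" for t
  proof -
    have "b * expectation (f t) = (\<integral>\<omega>. f t \<omega> * b \<partial>M)" by (simp add: mult.commute)
    also have "\<dots> \<le> (\<integral>\<omega>. f t \<omega> * real_cond_exp M N (g t) \<omega> \<partial>M)"
    proof (rule integral_mono_AE)
      show "integrable M (\<lambda>\<omega>. f t \<omega> * real_cond_exp M N (g t) \<omega>)"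
        by (rule real_cond_exp_intg(1)[OF fg_int[OF t] fN g(1)[OF t]])
      show "AE \<omega> in M. f t \<omega> * b \<le> f t \<omega> * real_cond_exp M N (g t) \<omega>"
        using lower[OF t]
      proof eventually_elim
        case (elim \<omega>)
        then show ?case using w(2)[of \<omega>]
          by (cases "w \<omega> = 0") (auto simp: f_def indicator_def intro!: mult_left_mono)
      qed
    qed (use f_int in auto)
    also have "\<dots> = expectation (\<lambda>\<omega>. f t \<omega> * g t \<omega>)"
      by (rule real_cond_exp_intg(2)[OF fg_int[OF t] fN g(1)[OF t]])
    finally show ?thesis .
  qed
  have "expectation w = expectation (\<lambda>\<omega>. \<Sum>t\<in>T. f t \<omega>)"
    using split[of _ "\<lambda>_. 1"] by (intro Bochner_Integration.integral_cong) auto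
  also have "\<dots> = (\<Sum>t\<in>T. expectation (f t))" using f_int by (intro Bochner_Integration.integral_sum)
  finally have "b * expectation w = (\<Sum>t\<in>T. b * expectation (f t))" by (simp add: sum_distrib_left)
  also have "\<dots> \<le> (\<Sum>t\<in>T. expectation (\<lambda>\<omega>. f t \<omega> * g t \<omega>))" by (rule sum_mono[OF piece])
  also have "\<dots> = expectation (\<lambda>\<omega>. \<Sum>t\<in>T. f t \<omega> * g t \<omega>)"
    using fg_int by (intro Bochner_Integration.integral_sum[symmetric])
  also have "\<dots> \<le> expectation H"
  proof (rule integral_mono_AE)
    show "AE \<omega> in M. (\<Sum>t\<in>T. f t \<omega> * g t \<omega>) \<le> H \<omega>"
      using H(2) AE_space by eventually_elim (simp add: split)
  qed (use fg_int H in auto)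
  finally show ?thesis .
qed

lemma borel_on_memI: "B \<in> sets borel \<Longrightarrow> X \<in> sets borel \<Longrightarrow> B \<subseteq> X \<Longrightarrow> B \<in> sets (borel_on X)"
  by (simp add: sets_restrict_space_iff)

context kernel_problem
begin

lemma X_borel: "X \<in> sets borel" by (rule borel_compact[OF X_compact])

lemma objective'_sq_integrable: "\<nu> \<in> nonneg_measures X \<Longrightarrow> integrable \<nu> (\<lambda>t. \<bar>J' \<mu> t\<bar>\<^sup>2)"
  by (intro continuous_integrable_nonneg_measure[OF _ X_compact] continuous_intros objective'_continuous)

text \<open>The scale \<open>\<tau>\<close> enters through \<open>J' \<le> (\<tau> + J'\<^sup>2/\<tau>)/2\<close>. This form is linear in the squared norm, so that
  expectations can be taken directly.\<close>

lemma objective_gap_le: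
  assumes \<nu>: "\<nu> \<in> nonneg_measures X" and \<mu>: "\<mu> \<in> nonneg_measures X" and \<tau>: "\<tau> > 0"
    and low: "\<And>t. t \<in> X \<Longrightarrow> - J' \<nu> t \<le> s"
  shows "J \<nu> - J \<mu> \<le> 1 / 2 * (\<tau> * measure \<nu> X + sq_norm \<nu> (J' \<nu>) / \<tau>) + s * measure \<mu> X"
proof -
  interpret finite_measure \<nu> using nonneg_measuresD(1)[OF \<nu>] .
  interpret \<mu>: finite_measure \<mu> using nonneg_measuresD(1)[OF \<mu>] .
  have "(\<integral>t. J' \<nu> t \<partial>\<nu>) \<le> (\<integral>t. 1 / 2 * (\<tau> + \<bar>J' \<nu> t\<bar>\<^sup>2 / \<tau>) \<partial>\<nu>)"
  proof (rule integral_mono)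
    show "integrable \<nu> (J' \<nu>)"
      by (rule continuous_integrable_nonneg_measure[OF \<nu> X_compact objective'_continuous])
    show "integrable \<nu> (\<lambda>t. 1 / 2 * (\<tau> + \<bar>J' \<nu> t\<bar>\<^sup>2 / \<tau>))"
      using objective'_sq_integrable[OF \<nu>, of \<nu>] by simp
    show "J' \<nu> t \<le> 1 / 2 * (\<tau> + \<bar>J' \<nu> t\<bar>\<^sup>2 / \<tau>)" for t
    proof -
      have "0 \<le> (\<tau> - J' \<nu> t)\<^sup>2" by simp
      then have "2 * \<tau> * J' \<nu> t \<le> \<tau>\<^sup>2 + (J' \<nu> t)\<^sup>2" by (simp add: power2_diff)
      then show ?thesis using \<tau> by (simp add: field_simps power2_eq_square)
    qed
  qed
  also have "\<dots> = 1 / 2 * (\<tau> * measure \<nu> X + sq_norm \<nu> (J' \<nu>) / \<tau>)"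
    using objective'_sq_integrable[OF \<nu>, of \<nu>] nonneg_measuresD(2)[OF \<nu>] by (simp add: sq_norm_def mult.commute)
  finally have 1: "(\<integral>t. J' \<nu> t \<partial>\<nu>) \<le> 1 / 2 * (\<tau> * measure \<nu> X + sq_norm \<nu> (J' \<nu>) / \<tau>)" .
  have int: "integrable \<mu> (J' \<nu>)"
    by (rule continuous_integrable_nonneg_measure[OF \<mu> X_compact objective'_continuous])
  have "- (\<integral>t. J' \<nu> t \<partial>\<mu>) = (\<integral>t. - J' \<nu> t \<partial>\<mu>)" by simp
  also have "\<dots> \<le> (\<integral>t. s \<partial>\<mu>)"
    by (rule integral_mono) (use int low nonneg_measuresD(2)[OF \<mu>] in auto)
  also have "\<dots> = s * measure \<mu> X" using nonneg_measuresD(2)[OF \<mu>] by simp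
  finally show ?thesis using 1 objective_convex_gap[OF \<nu> \<mu>] by linarith
qed

lemma sq_norm_ge:
  assumes \<nu>: "\<nu> \<in> nonneg_measures X" and B: "B \<in> sets (borel_on X)" and \<delta>: "0 \<le> \<delta>"
    and low: "\<And>x. x \<in> B \<Longrightarrow> J' \<nu> x \<le> - \<delta>"
  shows "\<delta>\<^sup>2 * measure \<nu> B \<le> sq_norm \<nu> (J' \<nu>)"
proof -
  interpret finite_measure \<nu> using nonneg_measuresD(1)[OF \<nu>] .
  have B': "B \<in> sets \<nu>" using B nonneg_measuresD(3)[OF \<nu>] by simp
  have "\<delta>\<^sup>2 * measure \<nu> B = (\<integral>t. \<delta>\<^sup>2 * indicator B t \<partial>\<nu>)" using B' by (simp add: Int_absorb2 sets.sets_into_space)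
  also have "\<dots> \<le> sq_norm \<nu> (J' \<nu>)"
    unfolding sq_norm_def
  proof (rule integral_mono)
    show "\<delta>\<^sup>2 * indicator B t \<le> \<bar>J' \<nu> t\<bar>\<^sup>2" for t
    proof (cases "t \<in> B")
      case True
      then have "\<delta>\<^sup>2 \<le> \<bar>J' \<nu> t\<bar>\<^sup>2" using low[OF True] \<delta> by (intro power_mono) auto
      then show ?thesis using True by simp
    qed simp
  qed (use B' objective'_sq_integrable[OF \<nu>, of \<nu>] in \<open>auto simp: emeasure_eq_measure\<close>)
  finally show ?thesis .
qed

end

text \<open>One exploration update in isolation: \<open>\<nu>p\<close> is the measure before it, \<open>\<nu>\<close> the measure after it, and \<open>N\<close> is
  the information available before it. The constants \<open>p\<close> and \<open>q\<close> stand for \<open>c \<epsilon>\<close> and \<open>C \<epsilon> K\<^bsup>-a\<^esup>\<close>. The variable \<open>G\<close> is a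
  majorant of the squared gradient norm. It replaces that norm in all expectations because the measurability in \<open>\<omega>\<close> of
  \<open>sq_norm (\<nu> \<omega>) (J' (\<nu> \<omega>))\<close>, where the measure and the integrand both vary, is not immediate.\<close>

locale exploration_step = kernel_problem X \<Phi> y \<kappa> cP CP + prob_space M
  for X :: "'a::euclidean_space set"
    and \<Phi> :: "('a set \<Rightarrow> real) \<Rightarrow> 'h::{real_inner, banach, second_countable_topology}"
    and y \<kappa> cP CP and M :: "'w measure" +
  fixes N :: "'w measure" and \<nu> \<nu>p :: "'w \<Rightarrow> 'a measure" and m \<eta> p q V r L \<theta> :: real
    and G :: "'w \<Rightarrow> real"
  assumes sub: "subalgebra M N"
    and \<nu>p: "\<And>\<omega>. \<omega> \<in> space M \<Longrightarrow> \<nu>p \<omega> \<in> nonneg_measures X"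
      "\<And>B. B \<in> sets (borel_on X) \<Longrightarrow> (\<lambda>\<omega>. measure (\<nu>p \<omega>) B) \<in> borel_measurable N"
    and \<nu>: "\<And>\<omega>. \<omega> \<in> space M \<Longrightarrow> \<nu> \<omega> \<in> nonneg_measures X"
      "\<And>B. B \<in> sets (borel_on X) \<Longrightarrow> (\<lambda>\<omega>. measure (\<nu> \<omega>) B) \<in> borel_measurable M"
    and mass: "AE \<omega> in M. measure (\<nu> \<omega>) X \<le> m"
    and close: "AE \<omega> in M. \<forall>t\<in>X. \<bar>J' (\<nu> \<omega>) t - J' (\<nu>p \<omega>) t\<bar> \<le> \<eta>"
    and explore: "\<And>B. B \<in> sets (borel_on X) \<Longrightarrow> AE \<omega> in M.
      real_cond_exp M N (\<lambda>\<omega>. measure (\<nu> \<omega>) B) \<omega>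
      \<ge> p * measure lborel (B \<inter> {t\<in>X. J' (\<nu>p \<omega>) t < 0}) - q"
    and p: "p \<ge> 0"
    and vol: "\<And>t. t \<in> X \<Longrightarrow> V \<le> measure lborel (X \<inter> cball t r)"
    and lip: "\<And>\<nu> s t. \<nu> \<in> nonneg_measures X \<Longrightarrow> measure \<nu> X \<le> m \<Longrightarrow> s \<in> X \<Longrightarrow> t \<in> X \<Longrightarrow>
      \<bar>J' \<nu> s - J' \<nu> t\<bar> \<le> L * dist s t" and L: "L \<ge> 0"
    and r: "r > 0" and \<theta>: "\<theta> > 0" "\<theta> \<ge> 2 * (L * r + 2 * \<eta>)"
    and G: "integrable M G" "AE \<omega> in M. sq_norm (\<nu> \<omega>) (J' (\<nu> \<omega>)) \<le> G \<omega>"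
begin

text \<open>The variable \<open>w\<close> is the depth of the dip at the selected net point, set to zero below the threshold \<open>\<theta>\<close>.
  Above the threshold the whole ball \<open>B\<close> around the net point lies in the set where \<open>J'\<close> is negative, for
  \<open>\<nu>p\<close> and for \<open>\<nu>\<close>; this is what \<open>\<theta> \<ge> 2 (L r + 2 \<eta>)\<close> ensures, with \<open>L r\<close> for moving within the ball
  and \<open>2 \<eta>\<close> for passing from \<open>\<nu>p\<close> to \<open>\<nu>\<close> and back. The Lipschitz bound is applied to \<open>\<nu>\<close> only, because the
  mass of \<open>\<nu>p\<close> is not controlled.\<close>

lemma negative_part_step:
  obtains w where "integrable M w" "(p * V - q) * \<theta> * (\<integral>\<omega>. w \<omega> \<partial>M) \<le> 4 * (\<integral>\<omega>. G \<omega> \<partial>M)"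
    "AE \<omega> in M. \<forall>t\<in>X. - J' (\<nu> \<omega>) t \<le> \<theta> + w \<omega> + L * r + \<eta>"
proof -
  have spN: "space N = space M" using sub by (simp add: subalgebra_def)
  obtain T where T: "finite T" "T \<subseteq> X" "\<And>x. x \<in> X \<Longrightarrow> \<exists>t\<in>T. dist x t < r"
    using compact_finite_net[OF X_compact r] by metis
  have Tne: "T \<noteq> {}" using nonempty T(3) by blast
  have "(\<lambda>\<omega>. - J' (\<nu>p \<omega>) t) \<in> borel_measurable N" for t
    using objective'_measurable[of N \<nu>p t] \<nu>p spN by simp
  then obtain \<sigma> where \<sigma>: "\<And>\<omega>. \<sigma> \<omega> \<in> T" "\<And>\<omega> t. t \<in> T \<Longrightarrow> - J' (\<nu>p \<omega>) t \<le> - J' (\<nu>p \<omega>) (\<sigma> \<omega>)"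
    "\<And>t. {\<omega> \<in> space N. \<sigma> \<omega> = t} \<in> sets N" "(\<lambda>\<omega>. - J' (\<nu>p \<omega>) (\<sigma> \<omega>)) \<in> borel_measurable N"
    by (rule finite_argmax_measurable[OF T(1) Tne, of "\<lambda>\<omega> t. - J' (\<nu>p \<omega>) t" N]) (rule that)
  define \<delta> where "\<delta> \<omega> = - J' (\<nu>p \<omega>) (\<sigma> \<omega>)" for \<omega>
  have \<delta>m: "\<delta> \<in> borel_measurable N" using \<sigma>(4) unfolding \<delta>_def by simp
  define w where "w \<omega> = (if \<theta> \<le> \<delta> \<omega> then \<delta> \<omega> else 0)" for \<omega>
  have wm: "w \<in> borel_measurable N" unfolding w_def using \<delta>m by measurable
  have w0: "0 \<le> w \<omega>" for \<omega> using \<theta>(1) by (simp add: w_def)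
  define B where "B t = X \<inter> cball t r" for t
  have B: "B t \<in> sets (borel_on X)" for t
    unfolding B_def by (intro borel_on_memI X_borel sets.Int) auto
  have B\<sigma>: "x \<in> X \<and> dist x (\<sigma> \<omega>) \<le> r" if "x \<in> B (\<sigma> \<omega>)" for x \<omega>
    using that by (auto simp: B_def dist_commute)
  have \<sigma>X: "\<sigma> \<omega> \<in> X" for \<omega> using T(2) \<sigma>(1) by blast
  have lip\<sigma>: "\<bar>J' (\<nu> \<omega>) x - J' (\<nu> \<omega>) (\<sigma> \<omega>)\<bar> \<le> L * r"
    if "\<omega> \<in> space M" "measure (\<nu> \<omega>) X \<le> m" "x \<in> B (\<sigma> \<omega>)" for x \<omega>
  proof -
    have "\<bar>J' (\<nu> \<omega>) x - J' (\<nu> \<omega>) (\<sigma> \<omega>)\<bar> \<le> L * dist x (\<sigma> \<omega>)"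
      using that B\<sigma>[OF that(3)] by (intro lip \<nu> \<sigma>X) auto
    also have "\<dots> \<le> L * r" using B\<sigma>[OF that(3)] L by (intro mult_left_mono) auto
    finally show ?thesis .
  qed
  have low: "J' (\<nu>p \<omega>) x \<le> - (\<delta> \<omega> / 2) \<and> J' (\<nu> \<omega>) x \<le> - (\<delta> \<omega> / 2)"
    if "\<omega> \<in> space M" "measure (\<nu> \<omega>) X \<le> m" "\<forall>t\<in>X. \<bar>J' (\<nu> \<omega>) t - J' (\<nu>p \<omega>) t\<bar> \<le> \<eta>"
      "x \<in> B (\<sigma> \<omega>)" "\<theta> \<le> \<delta> \<omega>" for x \<omega>
  proof -
    have 1: "\<bar>J' (\<nu> \<omega>) x - J' (\<nu>p \<omega>) x\<bar> \<le> \<eta>" using that(3) B\<sigma>[OF that(4)] by blast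
    have 2: "\<bar>J' (\<nu> \<omega>) (\<sigma> \<omega>) - J' (\<nu>p \<omega>) (\<sigma> \<omega>)\<bar> \<le> \<eta>" using that(3) \<sigma>X by blast
    show ?thesis using 1 2 lip\<sigma>[OF that(1,2,4)] that(5) \<theta>(2) unfolding \<delta>_def by (auto simp: abs_le_iff)
  qed
  \<comment> \<open>Almost sure boundedness makes \<open>w\<close> integrable.\<close>
  have \<delta>_bound: "AE \<omega> in M. \<delta> \<omega> \<le> m + CP + \<kappa> + \<eta>"
    using mass close AE_space
  proof eventually_elim
    case (elim \<omega>)
    have "\<bar>J' (\<nu> \<omega>) (\<sigma> \<omega>)\<bar> \<le> measure (\<nu> \<omega>) X + CP + \<kappa>"
      by (rule objective'_bound[OF \<nu>(1)[OF elim(3)] \<sigma>X])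
    moreover have "\<bar>J' (\<nu> \<omega>) (\<sigma> \<omega>) - J' (\<nu>p \<omega>) (\<sigma> \<omega>)\<bar> \<le> \<eta>" using elim(2) \<sigma>X by blast
    ultimately show ?case using elim(1) unfolding \<delta>_def by linarith
  qed
  define W where "W = max 0 (m + CP + \<kappa> + \<eta>)"
  have wW: "AE \<omega> in M. w \<omega> \<le> W"
    using \<delta>_bound by eventually_elim (auto simp: w_def W_def)
  have w_int: "integrable M w"
    by (rule integrable_const_bound[where B = W])
       (use wW w0 measurable_from_subalg[OF sub wm] in auto)
  have "(p * V - q) * expectation w \<le> expectation (\<lambda>\<omega>. 4 / \<theta> * G \<omega>)"
  proof (rule expectation_selected_ge[OF sub T(1) \<sigma>(1,3) wm w0 wW, where g = "\<lambda>t \<omega>. measure (\<nu> \<omega>) (B t)" and m = m])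
    show "AE \<omega> in M. measure (\<nu> \<omega>) (B t) \<le> m" for t
      using mass AE_space
    proof eventually_elim
      case (elim \<omega>)
      interpret \<nu>: finite_measure "\<nu> \<omega>" using nonneg_measuresD(1)[OF \<nu>(1)[OF elim(2)]] .
      show ?case using \<nu>.bounded_measure[of "B t"] nonneg_measuresD(2)[OF \<nu>(1)[OF elim(2)]] elim(1) by simp
    qed
    show "AE \<omega> in M. \<sigma> \<omega> = t \<longrightarrow> 0 < w \<omega> \<longrightarrow> p * V - q \<le> real_cond_exp M N (\<lambda>\<omega>. measure (\<nu> \<omega>) (B t)) \<omega>"
      if t: "t \<in> T" for t
      using mass close explore[OF B[of t]] AE_space
    proof eventually_elim
      case (elim \<omega>)
      show ?case
      proof (intro impI)
        assume s: "\<sigma> \<omega> = t" and "0 < w \<omega>"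
        then have \<delta>: "\<theta> \<le> \<delta> \<omega>" by (auto simp: w_def split: if_splits)
        have "B t \<inter> {t\<in>X. J' (\<nu>p \<omega>) t < 0} = B t"
          using low[OF elim(4,1,2) _ \<delta>] \<delta> \<theta>(1) B\<sigma>[of _ \<omega>] s by fastforce
        moreover have "p * V \<le> p * measure lborel (B t)"
          using vol[of t] t T(2) p by (intro mult_left_mono) (auto simp: B_def)
        ultimately show "p * V - q \<le> real_cond_exp M N (\<lambda>\<omega>. measure (\<nu> \<omega>) (B t)) \<omega>"
          using elim(3) by simp
      qed
    qed
    show "AE \<omega> in M. w \<omega> * measure (\<nu> \<omega>) (B (\<sigma> \<omega>)) \<le> 4 / \<theta> * G \<omega>"
      using mass close G(2) AE_space
    proof eventually_elim
      case (elim \<omega>)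
      show ?case
      proof (cases "\<theta> \<le> \<delta> \<omega>")
        case True
        have "(\<delta> \<omega> / 2)\<^sup>2 * measure (\<nu> \<omega>) (B (\<sigma> \<omega>)) \<le> G \<omega>"
          using sq_norm_ge[OF \<nu>(1)[OF elim(4)] B, of "\<delta> \<omega> / 2" "\<sigma> \<omega>"] low[OF elim(4,1,2) _ True]
            True \<theta>(1) elim(3) by fastforce
        moreover have "\<theta> * \<delta> \<omega> * measure (\<nu> \<omega>) (B (\<sigma> \<omega>)) \<le> (\<delta> \<omega>)\<^sup>2 * measure (\<nu> \<omega>) (B (\<sigma> \<omega>))"
          using True \<theta>(1) by (intro mult_right_mono) (auto simp: power2_eq_square)
        ultimately have "\<theta> * (\<delta> \<omega> * measure (\<nu> \<omega>) (B (\<sigma> \<omega>))) \<le> 4 * G \<omega>"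
          by (simp add: power_divide mult.assoc)
        then show ?thesis using True \<theta>(1) by (simp add: w_def field_simps)
      next
        case False
        have "0 \<le> sq_norm (\<nu> \<omega>) (J' (\<nu> \<omega>))" unfolding sq_norm_def by simp
        then have "0 \<le> G \<omega>" using elim(3) by linarith
        then show ?thesis using False \<theta>(1) by (simp add: w_def)
      qed
    qed
  qed (use \<nu>(2) B G(1) in auto)
  then have "(p * V - q) * \<theta> * expectation w \<le> 4 * expectation G"
    using \<theta>(1) by (simp add: field_simps)
  moreover have "AE \<omega> in M. \<forall>t\<in>X. - J' (\<nu> \<omega>) t \<le> \<theta> + w \<omega> + L * r + \<eta>"
    using mass close AE_space
  proof eventually_elim
    case (elim \<omega>)
    show ?case
    proof
      fix x assume x: "x \<in> X"
      obtain t where t: "t \<in> T" "dist x t < r" using T(3)[OF x] by blast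
      have "\<bar>J' (\<nu> \<omega>) x - J' (\<nu> \<omega>) t\<bar> \<le> L * dist x t"
        using t T(2) x by (intro lip \<nu> elim) auto
      also have "\<dots> \<le> L * r" using t(2) L by (intro mult_left_mono) auto
      finally have 1: "\<bar>J' (\<nu> \<omega>) x - J' (\<nu> \<omega>) t\<bar> \<le> L * r" .
      have 2: "\<bar>J' (\<nu> \<omega>) t - J' (\<nu>p \<omega>) t\<bar> \<le> \<eta>" using elim(2) t(1) T(2) by blast
      have 3: "- J' (\<nu>p \<omega>) t \<le> \<delta> \<omega>" unfolding \<delta>_def by (rule \<sigma>(2)[OF t(1)])
      have 4: "\<delta> \<omega> \<le> \<theta> + w \<omega>" using \<theta>(1) by (auto simp: w_def)
      show "- J' (\<nu> \<omega>) x \<le> \<theta> + w \<omega> + L * r + \<eta>"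
        using 1 2 3 4 by linarith
    qed
  qed
  ultimately show thesis using that w_int by blast
qed

lemma expected_gap_step:
  assumes b: "0 < b" "b \<le> p * V - q" and \<tau>: "\<tau> > 0" and \<mu>: "\<mu> \<in> nonneg_measures X"
  shows "integrable M (\<lambda>\<omega>. J (\<nu> \<omega>))"
    and "(\<integral>\<omega>. J (\<nu> \<omega>) - J \<mu> \<partial>M) \<le> 1 / 2 * \<tau> * m + (\<theta> + L * r + \<eta>) * measure \<mu> X
      + (1 / (2 * \<tau>) + 4 * measure \<mu> X / (b * \<theta>)) * (\<integral>\<omega>. G \<omega> \<partial>M)"
proof -
  have Jm: "(\<lambda>\<omega>. J (\<nu> \<omega>)) \<in> borel_measurable M"
    by (rule objective_measurable) (use \<nu> in auto)
  show int: "integrable M (\<lambda>\<omega>. J (\<nu> \<omega>))"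
  proof (rule integrable_const_bound[where B = "1 / 2 * (m + CP)\<^sup>2 + \<kappa> * m"])
    show "AE \<omega> in M. norm (J (\<nu> \<omega>)) \<le> 1 / 2 * (m + CP)\<^sup>2 + \<kappa> * m"
      using mass AE_space
      by eventually_elim (use objective_bounds \<nu>(1) in auto)
  qed (rule Jm)
  obtain w where w: "integrable M w" "(p * V - q) * \<theta> * (\<integral>\<omega>. w \<omega> \<partial>M) \<le> 4 * (\<integral>\<omega>. G \<omega> \<partial>M)"
    "AE \<omega> in M. \<forall>t\<in>X. - J' (\<nu> \<omega>) t \<le> \<theta> + w \<omega> + L * r + \<eta>"
    by (rule negative_part_step) (rule that)
  let ?f = "\<lambda>\<omega>. 1 / 2 * (\<tau> * m + G \<omega> / \<tau>) + (\<theta> + w \<omega> + L * r + \<eta>) * measure \<mu> X"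
  have "(\<integral>\<omega>. J (\<nu> \<omega>) - J \<mu> \<partial>M) \<le> (\<integral>\<omega>. ?f \<omega> \<partial>M)"
  proof (rule integral_mono_AE)
    show "AE \<omega> in M. J (\<nu> \<omega>) - J \<mu> \<le> ?f \<omega>"
      using w(3) mass G(2) AE_space
    proof eventually_elim
      case (elim \<omega>)
      have "J (\<nu> \<omega>) - J \<mu> \<le> 1 / 2 * (\<tau> * measure (\<nu> \<omega>) X + sq_norm (\<nu> \<omega>) (J' (\<nu> \<omega>)) / \<tau>)
          + (\<theta> + w \<omega> + L * r + \<eta>) * measure \<mu> X"
        using elim(1) by (intro objective_gap_le \<nu> elim \<mu> \<tau>) auto
      also have "\<dots> \<le> ?f \<omega>"
        using elim \<tau> by (intro add_right_mono mult_left_mono add_mono divide_right_mono) auto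
      finally show ?case .
    qed
  qed (use int w G in auto)
  also have "\<dots> = 1 / 2 * \<tau> * m + (\<theta> + L * r + \<eta>) * measure \<mu> X
      + 1 / (2 * \<tau>) * expectation G + expectation w * measure \<mu> X"
    using w(1) G(1) by (simp add: prob_space algebra_simps)
  also have "expectation w * measure \<mu> X \<le> 4 * measure \<mu> X / (b * \<theta>) * expectation G"
  proof -
    have G0: "0 \<le> expectation G"
      using G(2) by (intro integral_nonneg_AE) (auto elim!: eventually_mono intro: order_trans[rotated] simp: sq_norm_def)
    have "expectation w \<le> 4 * expectation G / (b * \<theta>)"
    proof (cases "0 \<le> expectation w")
      case True
      have "b * \<theta> * expectation w \<le> (p * V - q) * \<theta> * expectation w"
        using True b \<theta>(1) by (intro mult_right_mono) auto
      with w(2) have "b * \<theta> * expectation w \<le> 4 * expectation G" by linarith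
      then show ?thesis using b \<theta>(1) by (simp add: field_simps)
    next
      case False
      then show ?thesis using G0 b \<theta>(1) by (smt (verit) divide_nonneg_pos mult_pos_pos)
    qed
    then have "expectation w * measure \<mu> X \<le> 4 * expectation G / (b * \<theta>) * measure \<mu> X"
      by (intro mult_right_mono) auto
    then show ?thesis by (simp add: mult_ac)
  qed
  finally show "(\<integral>\<omega>. J (\<nu> \<omega>) - J \<mu> \<partial>M) \<le> 1 / 2 * \<tau> * m + (\<theta> + L * r + \<eta>) * measure \<mu> X
      + (1 / (2 * \<tau>) + 4 * measure \<mu> X / (b * \<theta>)) * (\<integral>\<omega>. G \<omega> \<partial>M)"
    by (simp add: algebra_simps)
qed

end

section \<open>Summation over the iterations\<close>

context kernel_problem
begin

text \<open>The descent hypothesis itself supplies the integrable majorant \<open>G k\<close> of the squared gradient norm. Its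
  expectations telescope, the objective lying between \<open>0\<close> and a constant that depends on the mass bound \<open>m\<close>. The sum runs over
  the measures with indices \<open>2\<close> to \<open>K\<close> because an exploration update precedes each of them; this is where
  \<open>K - 1\<close> comes from.\<close>

lemma expected_best_gap_le:
  fixes M :: "'w measure" and F Fp :: "nat \<Rightarrow> 'w measure" and \<nu> \<nu>p :: "nat \<Rightarrow> 'w \<Rightarrow> 'a measure"
  assumes M: "prob_space M" and filt: "interlaced_filtrations M F Fp"
    and ad: "measure_adapted X M F \<nu>" "measure_adapted X M Fp \<nu>p"
    and TV: "hyp_TV X M \<nu> m"
    and D: "hyp_D J J' M F \<nu> \<nu>p \<alpha> \<beta> (\<lambda>k. K) C\<^sub>D"
    and plus: "hyp_plus X J' M Fp \<nu> \<nu>p (\<lambda>k. \<epsilon>) (\<lambda>k. K) a c\<^sub>E C\<^sub>E"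
    and sm1: "hyp_smooth1 J M Fp \<nu> \<nu>p (\<lambda>k. \<epsilon>) (\<lambda>k. K) C\<^sub>1"
    and sm2: "hyp_smooth2 X J' M \<nu> \<nu>p (\<lambda>k. \<epsilon>) C\<^sub>2"
    and K: "K \<ge> 2" and \<alpha>: "\<alpha> > 0" and \<epsilon>: "\<epsilon> \<ge> 0" and c\<^sub>E: "c\<^sub>E \<ge> 0"
    and vol: "\<And>t. t \<in> X \<Longrightarrow> V \<le> measure lborel (X \<inter> cball t r)"
    and lip: "\<And>\<nu> s t. \<nu> \<in> nonneg_measures X \<Longrightarrow> measure \<nu> X \<le> m \<Longrightarrow> s \<in> X \<Longrightarrow> t \<in> X \<Longrightarrow>
      \<bar>J' \<nu> s - J' \<nu> t\<bar> \<le> L * dist s t" and L: "L \<ge> 0"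
    and r: "r > 0" and \<theta>: "\<theta> > 0" "\<theta> \<ge> 2 * (L * r + 2 * (C\<^sub>2 * \<epsilon>))"
    and b: "0 < b" "b \<le> c\<^sub>E * \<epsilon> * V - C\<^sub>E * \<epsilon> * real K powr (- a)" and \<tau>: "\<tau> > 0"
    and \<mu>: "\<mu> \<in> nonneg_measures X" "\<And>\<nu>. \<nu> \<in> nonneg_measures X \<Longrightarrow> J \<mu> \<le> J \<nu>"
  shows "prob_space.expectation M (best_gap J \<mu> \<nu> K) \<le>
     1 / 2 * \<tau> * m + (\<theta> + L * r + C\<^sub>2 * \<epsilon>) * measure \<mu> X +
     (1 / (2 * \<tau>) + 4 * measure \<mu> X / (b * \<theta>)) *
       (2 / \<alpha> * ((1 / 2 * (m + CP)\<^sup>2 + \<kappa> * m) / (real K - 1)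
         + C\<^sub>D * (\<alpha>\<^sup>2 / real K + \<beta>\<^sup>2 + \<beta> / real K)
         + C\<^sub>1 * (\<epsilon>\<^sup>2 + \<epsilon> * sqrt (ln (real K) / real K))))"
    (is "_ \<le> ?c0 + ?c1 * (2 / \<alpha> * (?J0 / _ + ?eD + ?e1))")
proof -
  interpret prob_space M by (rule M)
  have subF: "subalgebra M (F k)" and subFp: "subalgebra M (Fp k)" for k
    using filt by (auto simp: interlaced_filtrations_def)
  have \<nu>: "\<nu> k \<omega> \<in> nonneg_measures X" and \<nu>p: "\<nu>p k \<omega> \<in> nonneg_measures X" if "\<omega> \<in> space M" for k \<omega>
    using ad that by (auto simp: measure_adapted_def)
  have \<nu>m: "(\<lambda>\<omega>. measure (\<nu> k \<omega>) B) \<in> borel_measurable M"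
    and \<nu>pm: "(\<lambda>\<omega>. measure (\<nu>p k \<omega>) B) \<in> borel_measurable (Fp k)" if "B \<in> sets (borel_on X)" for k B
    using ad that by (auto simp: measure_adapted_def intro: measurable_from_subalg[OF subF])
  have mass: "AE \<omega> in M. measure (\<nu> k \<omega>) X \<le> m" for k
  proof -
    have "AE \<omega> in M. tv_norm X (measure (\<nu> k \<omega>)) \<le> m" using TV by (simp add: hyp_TV_def)
    then show ?thesis using AE_space by eventually_elim (simp add: tv_norm_measure \<nu>)
  qed
  have J_bound: "AE \<omega> in M. 0 \<le> J (\<nu> k \<omega>) \<and> J (\<nu> k \<omega>) \<le> ?J0" for k
    using mass[of k] AE_space by eventually_elim (use objective_bounds[OF \<nu>] in auto)
  have J_int: "integrable M (\<lambda>\<omega>. J (\<nu> k \<omega>))" for k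
  proof (rule integrable_const_bound[where B = ?J0])
    show "(\<lambda>\<omega>. J (\<nu> k \<omega>)) \<in> borel_measurable M"
      by (rule objective_measurable) (use \<nu> \<nu>m in auto)
    show "AE \<omega> in M. norm (J (\<nu> k \<omega>)) \<le> ?J0" using J_bound[of k] by eventually_elim auto
  qed
  have Jp_int: "integrable M (\<lambda>\<omega>. J (\<nu>p k \<omega>))" if "k \<ge> 1" for k
    using D that by (simp add: hyp_D_def)
  define A where "A k = expectation (\<lambda>\<omega>. J (\<nu> k \<omega>))" for k
  define G where "G k \<omega> = 2 / \<alpha> * (J (\<nu> k \<omega>) - real_cond_exp M (F k) (\<lambda>\<omega>. J (\<nu>p k \<omega>)) \<omega> + ?eD)" for k \<omega>
  have EG: "integrable M (G k)" "expectation (G k) \<le> 2 / \<alpha> * (A k - A (Suc k) + ?eD + ?e1)" if k: "k \<ge> 1" for k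
  proof -
    interpret FF: finite_measure_subalgebra M "F k" by standard (rule subF)
    interpret FFp: finite_measure_subalgebra M "Fp k" by standard (rule subFp)
    have ci: "integrable M (real_cond_exp M (F k) (\<lambda>\<omega>. J (\<nu>p k \<omega>)))"
      by (rule FF.real_cond_exp_int(1)[OF Jp_int[OF k]])
    show "integrable M (G k)" unfolding G_def using ci J_int by auto
    have "expectation (G k) = 2 / \<alpha> * (A k - expectation (\<lambda>\<omega>. J (\<nu>p k \<omega>)) + ?eD)"
      unfolding G_def A_def using ci J_int by (simp add: prob_space FF.real_cond_exp_int(2)[OF Jp_int[OF k]])
    moreover have "A (Suc k) - expectation (\<lambda>\<omega>. J (\<nu>p k \<omega>)) \<le> ?e1"
    proof -
      have i: "integrable M (\<lambda>\<omega>. J (\<nu> (Suc k) \<omega>) - J (\<nu>p k \<omega>))" using J_int Jp_int[OF k] by simp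
      have "A (Suc k) - expectation (\<lambda>\<omega>. J (\<nu>p k \<omega>)) = expectation (\<lambda>\<omega>. J (\<nu> (Suc k) \<omega>) - J (\<nu>p k \<omega>))"
        unfolding A_def using J_int Jp_int[OF k] by simp
      also have "\<dots> = expectation (real_cond_exp M (Fp k) (\<lambda>\<omega>. J (\<nu> (Suc k) \<omega>) - J (\<nu>p k \<omega>)))"
        by (rule FFp.real_cond_exp_int(2)[OF i, symmetric])
      also have "\<dots> \<le> expectation (\<lambda>\<omega>. ?e1)"
        using sm1 k by (intro integral_mono_AE FFp.real_cond_exp_int(1)[OF i]) (auto simp: hyp_smooth1_def)
      finally show ?thesis by (simp add: prob_space)
    qed
    then have "A k - expectation (\<lambda>\<omega>. J (\<nu>p k \<omega>)) + ?eD \<le> A k - A (Suc k) + ?eD + ?e1" by linarith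
    then have "2 / \<alpha> * (A k - expectation (\<lambda>\<omega>. J (\<nu>p k \<omega>)) + ?eD) \<le> 2 / \<alpha> * (A k - A (Suc k) + ?eD + ?e1)"
      using \<alpha> by (intro mult_left_mono) auto
    ultimately show "expectation (G k) \<le> 2 / \<alpha> * (A k - A (Suc k) + ?eD + ?e1)"
      by (simp only:)
  qed
  have sq_G: "AE \<omega> in M. sq_norm (\<nu> k \<omega>) (J' (\<nu> k \<omega>)) \<le> G k \<omega>" if "k \<ge> 1" for k
  proof -
    have "AE \<omega> in M. real_cond_exp M (F k) (\<lambda>\<omega>. J (\<nu>p k \<omega>)) \<omega> - J (\<nu> k \<omega>)
          \<le> - (\<alpha> / 2) * sq_norm (\<nu> k \<omega>) (J' (\<nu> k \<omega>)) + ?eD"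
      using D that unfolding hyp_D_def by blast
    then show ?thesis
    proof eventually_elim
      case (elim \<omega>)
      then have "\<alpha> / 2 * sq_norm (\<nu> k \<omega>) (J' (\<nu> k \<omega>)) \<le>
          J (\<nu> k \<omega>) - real_cond_exp M (F k) (\<lambda>\<omega>. J (\<nu>p k \<omega>)) \<omega> + ?eD"
        unfolding minus_mult_left[symmetric] by linarith
      then have "2 / \<alpha> * (\<alpha> / 2 * sq_norm (\<nu> k \<omega>) (J' (\<nu> k \<omega>))) \<le> G k \<omega>"
        unfolding G_def using \<alpha> by (intro mult_left_mono) auto
      then show ?case using \<alpha> by simp
    qed
  qed
  have step: "expectation (best_gap J \<mu> \<nu> K) \<le> ?c0 + ?c1 * expectation (G (Suc k))"
    if k: "k \<in> {1..<K}" for k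
  proof -
    \<comment> \<open>The majorant for \<open>\<nu> (Suc k)\<close> comes from the descent step that follows the exploration update \<open>k\<close>.\<close>
    have "exploration_step X \<Phi> y \<kappa> cP CP M (Fp k) (\<nu> (Suc k)) (\<nu>p k) m (C\<^sub>2 * \<epsilon>)
      (c\<^sub>E * \<epsilon>) (C\<^sub>E * \<epsilon> * real K powr (- a)) V r L \<theta> (G (Suc k))"
    proof unfold_locales
      show "AE \<omega> in M. \<forall>t\<in>X. \<bar>J' (\<nu> (Suc k) \<omega>) t - J' (\<nu>p k \<omega>) t\<bar> \<le> C\<^sub>2 * \<epsilon>"
        using sm2 k by (simp add: hyp_smooth2_def)
      show "AE \<omega> in M. c\<^sub>E * \<epsilon> * measure lborel (B \<inter> {t \<in> X. J' (\<nu>p k \<omega>) t < 0}) - C\<^sub>E * \<epsilon> * real K powr - a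
          \<le> real_cond_exp M (Fp k) (\<lambda>\<omega>. measure (\<nu> (Suc k) \<omega>) B) \<omega>" if "B \<in> sets (borel_on X)" for B
        using plus that unfolding hyp_plus_def by blast
      show "0 \<le> c\<^sub>E * \<epsilon>" using c\<^sub>E \<epsilon> by simp
      show "integrable M (G (Suc k))" by (rule EG(1)) simp
      show "AE \<omega> in M. sq_norm (\<nu> (Suc k) \<omega>) (J' (\<nu> (Suc k) \<omega>)) \<le> G (Suc k) \<omega>" by (rule sq_G) simp
    qed (fact subFp \<nu>p \<nu>pm \<nu> \<nu>m mass vol lip L r \<theta>)+
    then interpret st: exploration_step X \<Phi> y \<kappa> cP CP M "Fp k" "\<nu> (Suc k)" "\<nu>p k" m "C\<^sub>2 * \<epsilon>"
      "c\<^sub>E * \<epsilon>" "C\<^sub>E * \<epsilon> * real K powr (- a)" V r L \<theta> "G (Suc k)" .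
    have "expectation (best_gap J \<mu> \<nu> K) \<le> expectation (\<lambda>\<omega>. J (\<nu> (Suc k) \<omega>) - J \<mu>)"
    proof (rule integral_mono_AE')
      show "AE \<omega> in M. best_gap J \<mu> \<nu> K \<omega> \<le> J (\<nu> (Suc k) \<omega>) - J \<mu>"
        unfolding best_gap_def using k by (intro AE_I2 Min_le) auto
      show "AE \<omega> in M. 0 \<le> J (\<nu> (Suc k) \<omega>) - J \<mu>"
        using \<mu>(2)[OF \<nu>] by (intro AE_I2) auto
    qed (use J_int in simp)
    also have "\<dots> \<le> ?c0 + ?c1 * expectation (G (Suc k))"
      by (rule st.expected_gap_step(2)[OF b \<tau> \<mu>(1)])
    finally show ?thesis .
  qed
  have const_sum: "(\<Sum>k\<in>{1..<K}. e) = (real K - 1) * e" for e :: real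
    using K by (simp add: of_nat_diff)
  have c1: "0 \<le> ?c1" using \<tau> b(1) \<theta>(1) by (intro add_nonneg_nonneg divide_nonneg_nonneg) auto
  have "(real K - 1) * expectation (best_gap J \<mu> \<nu> K) = (\<Sum>k\<in>{1..<K}. expectation (best_gap J \<mu> \<nu> K))"
    by (simp only: const_sum)
  also have "\<dots> \<le> (\<Sum>k\<in>{1..<K}. ?c0 + ?c1 * expectation (G (Suc k)))" by (rule sum_mono[OF step])
  also have "\<dots> = (real K - 1) * ?c0 + ?c1 * (\<Sum>k\<in>{1..<K}. expectation (G (Suc k)))"
    by (subst sum.distrib) (simp only: const_sum sum_distrib_left)
  also have "\<dots> \<le> (real K - 1) * ?c0 + ?c1 * (2 / \<alpha> * (?J0 + (real K - 1) * (?eD + ?e1)))"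
  proof (intro add_left_mono mult_left_mono c1)
    have "(\<Sum>k\<in>{1..<K}. expectation (G (Suc k))) \<le>
        (\<Sum>k\<in>{1..<K}. 2 / \<alpha> * (A (Suc k) - A (Suc (Suc k)) + (?eD + ?e1)))"
      using EG(2)[of "Suc _"] by (intro sum_mono) (simp add: add.assoc)
    also have "\<dots> = 2 / \<alpha> * ((\<Sum>k\<in>{1..<K}. A (Suc k) - A (Suc (Suc k))) + (real K - 1) * (?eD + ?e1))"
      by (subst sum_distrib_left[symmetric], subst sum.distrib) (simp only: const_sum)
    also have "(\<Sum>k\<in>{1..<K}. A (Suc k) - A (Suc (Suc k))) = A 2 - A (Suc K)"
      using K sum_Suc_diff'[of 1 K "\<lambda>k. - A (Suc k)"] by (simp add: numeral_2_eq_2)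
    also have "2 / \<alpha> * (A 2 - A (Suc K) + (real K - 1) * (?eD + ?e1)) \<le> 2 / \<alpha> * (?J0 + (real K - 1) * (?eD + ?e1))"
    proof -
      have "A 2 \<le> expectation (\<lambda>_. ?J0)"
        unfolding A_def using J_bound[of 2] J_int by (intro integral_mono_AE) auto
      moreover have "0 \<le> A (Suc K)"
        unfolding A_def using J_bound[of "Suc K"] by (intro integral_nonneg_AE) auto
      ultimately show ?thesis using \<alpha> by (intro mult_left_mono) (auto simp: prob_space)
    qed
    finally show "(\<Sum>k\<in>{1..<K}. expectation (G (Suc k))) \<le> 2 / \<alpha> * (?J0 + (real K - 1) * (?eD + ?e1))" .
  qed
  also have "\<dots> = (real K - 1) * (?c0 + ?c1 * (2 / \<alpha> * (?J0 / (real K - 1) + ?eD + ?e1)))"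
  proof -
    have "?J0 + (real K - 1) * (?eD + ?e1) = (real K - 1) * (?J0 / (real K - 1) + ?eD + ?e1)"
    proof -
      have "j + n * (d + e) = n * (j / n + d + e)" if "n > 0" for j n d e :: real
        using that by (simp add: field_simps)
      then show ?thesis using K by simp
    qed
    then show ?thesis by (simp only: distrib_left mult.left_commute mult.assoc)
  qed
  finally show ?thesis using K by (simp only: mult_le_cancel_left)
qed

end

section \<open>Arithmetic of the rate\<close>

definition rate :: "nat \<Rightarrow> real \<Rightarrow> nat \<Rightarrow> real" where
  "rate d \<alpha> K = \<alpha> powr (- (1 / 2)) * (ln (real K) / real K) powr (1 / (2 * (2 + real d)))"

lemma rate_pos: "K \<ge> 2 \<Longrightarrow> \<alpha> > 0 \<Longrightarrow> rate d \<alpha> K > 0"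
  by (simp add: rate_def)

lemma rate_power:
  assumes "K \<ge> 2" "\<alpha> > 0"
  shows "rate d \<alpha> K ^ n = \<alpha> powr (- (real n / 2)) * (ln (real K) / real K) powr (real n / (2 * (2 + real d)))"
proof -
  have "ln (real K) > 0" using assms by simp
  then show ?thesis using assms
    by (simp add: rate_def power_mult_distrib powr_power)
qed

lemma log_ratio_powr_ge:
  assumes K: "K \<ge> 2" and s: "0 \<le> s" "s \<le> 1"
  shows "ln 2 * real K powr (- s) \<le> (ln (real K) / real K) powr s"
proof -
  have l2: "0 < ln (2::real)" "ln (2::real) \<le> 1" using ln_2_less_1 by auto
  have "ln 2 = ln (2::real) powr 1" using l2 by simp
  also have "\<dots> \<le> ln 2 powr s" using s l2 by (intro powr_mono') auto
  also have "\<dots> \<le> ln (real K) powr s" using K s l2 by (intro powr_mono2) auto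
  finally have "ln 2 * real K powr (- s) \<le> ln (real K) powr s * real K powr (- s)"
    by (intro mult_right_mono) auto
  also have "\<dots> = (ln (real K) / real K) powr s" using K by (simp add: powr_divide powr_minus_divide)
  finally show ?thesis .
qed

text \<open>Powers of the rate dominate the error terms \<open>\<epsilon> = K\<^bsup>-1/2\<^esup>\<close> (with \<open>n = 1\<close>) and \<open>K\<^bsup>-a\<^esup>\<close> (with \<open>n = d\<close>). The condition
  on \<open>a\<close> in the theorem is the case \<open>n = d\<close> of the one on \<open>s\<close>.\<close>

lemma rate_power_ge:
  assumes K: "K \<ge> 2" and \<alpha>: "0 < \<alpha>" "\<alpha> \<le> \<alpha>m" and n: "real n \<le> 2 * (2 + real d)"
    and s: "s \<ge> real n / (2 * (2 + real d))"
  shows "real K powr (- s) \<le> \<alpha>m powr (real n / 2) / ln 2 * rate d \<alpha> K ^ n"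
proof -
  let ?s = "real n / (2 * (2 + real d))"
  have l2: "0 < ln (2::real)" by simp
  have "real K powr (- s) \<le> real K powr (- ?s)" using K s by (intro powr_mono) auto
  also have "\<dots> \<le> (ln (real K) / real K) powr ?s / ln 2"
    using log_ratio_powr_ge[OF K, of ?s] n l2 by (simp add: field_simps)
  also have "\<dots> \<le> \<alpha>m powr (real n / 2) * \<alpha> powr (- (real n / 2)) * ((ln (real K) / real K) powr ?s / ln 2)"
  proof -
    have "1 = \<alpha> powr (real n / 2) * \<alpha> powr (- (real n / 2))" using \<alpha> by (simp flip: powr_add)
    also have "\<dots> \<le> \<alpha>m powr (real n / 2) * \<alpha> powr (- (real n / 2))"
      using \<alpha> by (intro mult_right_mono powr_mono2) auto
    finally have "1 * ((ln (real K) / real K) powr ?s / ln 2) \<le>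
        \<alpha>m powr (real n / 2) * \<alpha> powr (- (real n / 2)) * ((ln (real K) / real K) powr ?s / ln 2)"
      using l2 by (intro mult_right_mono) auto
    then show ?thesis by simp
  qed
  finally show ?thesis using rate_power[OF K \<alpha>(1), of d n] by (simp add: mult_ac)
qed

text \<open>All terms are compared with \<open>Z = \<alpha>\<^bsup>-d/2\<^esup> \<surd>(ln K / ln 2)\<close> after multiplication by \<open>K\<close>. The upper bound \<open>\<alpha>m\<close> on the step
  size turns constants into multiples of \<open>\<alpha>\<^bsup>-d/2\<^esup>\<close>, and the choice of \<open>\<beta>\<close> is exactly \<open>K \<beta>\<^sup>2 \<le> \<alpha>\<^bsup>-d/2\<^esup>\<close>. The
  remaining factor \<open>1/\<alpha>\<close> then completes the power \<open>\<tau>\<^bsup>d+2\<^esup> = \<alpha>\<^bsup>-(d+2)/2\<^esup> \<surd>(ln K / K)\<close>.\<close>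

lemma averaged_descent_le:
  fixes J0 C\<^sub>D C\<^sub>1 \<alpha> \<beta> \<alpha>m :: real
  assumes K: "K \<ge> 2" and \<alpha>: "0 < \<alpha>" "\<alpha> \<le> \<alpha>m" and nn: "J0 \<ge> 0" "C\<^sub>D \<ge> 0" "C\<^sub>1 \<ge> 0"
    and \<beta>: "0 < \<beta>" "\<beta> \<le> 1 / (\<alpha> powr (real d / 4) * sqrt (real K))"
  defines "P \<equiv> \<alpha>m powr (real d / 2)"
  shows "2 / \<alpha> * (J0 / (real K - 1) + C\<^sub>D * (\<alpha>\<^sup>2 / real K + \<beta>\<^sup>2 + \<beta> / real K)
      + C\<^sub>1 * ((1 / sqrt (real K))\<^sup>2 + 1 / sqrt (real K) * sqrt (ln (real K) / real K)))
    \<le> 2 * (2 * J0 * P + C\<^sub>D * (\<alpha>m\<^sup>2 * P + 3 / 2 + P / 2) + 2 * C\<^sub>1 * P) / sqrt (ln 2)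
      * rate d \<alpha> K ^ (d + 2) / sqrt (real K)"
proof -
  define l where "l = sqrt (ln (real K))"
  define l2 where "l2 = sqrt (ln (2::real))"
  define x where "x = \<alpha> powr (- (real d / 2))"
  have l2: "0 < l2" "l2 \<le> 1" "l2 \<le> l" using K ln_2_less_1 by (auto simp: l_def l2_def)
  have l: "0 < l" using l2 by linarith
  have x: "0 < x" using \<alpha> by (simp add: x_def)
  have P: "P > 0" using \<alpha> by (simp add: P_def)
  have Px: "1 \<le> P * x"
  proof -
    have "1 = \<alpha> powr (real d / 2) * x" using \<alpha> by (simp add: x_def flip: powr_add)
    also have "\<dots> \<le> P * x" unfolding P_def using \<alpha> x by (intro mult_right_mono powr_mono2) auto
    finally show ?thesis .
  qed
  define Z where "Z = x * l / l2"
  have Z0: "0 < Z" using x l l2 by (simp add: Z_def)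
  have xZ: "x \<le> Z" using x l2 by (simp add: Z_def field_simps)
  have oneZ: "1 \<le> P * Z"
  proof -
    have "P * x \<le> P * Z" using xZ P by simp
    with Px show ?thesis by linarith
  qed
  have lZ: "l \<le> P * Z"
  proof -
    have "l * 1 \<le> (l / l2) * (P * x)" using Px l l2 x P by (intro mult_mono) (auto simp: field_simps)
    then show ?thesis by (simp add: Z_def field_simps)
  qed
  have K\<beta>: "real K * \<beta>\<^sup>2 \<le> x"
  proof -
    have "\<beta>\<^sup>2 \<le> (1 / (\<alpha> powr (real d / 4) * sqrt (real K)))\<^sup>2" using \<beta> by (intro power_mono) auto
    also have "\<dots> = x / real K"
      using \<alpha> K by (simp add: x_def power_divide power_mult_distrib powr_power powr_minus field_simps)
    finally show ?thesis using K by (simp add: field_simps)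
  qed
  have \<beta>x: "\<beta> \<le> 1 / 2 + x / 2"
  proof -
    have "2 * \<beta> \<le> 1 + \<beta>\<^sup>2" using zero_le_power2[of "1 - \<beta>"] by (simp add: power2_diff)
    moreover have "1 * \<beta>\<^sup>2 \<le> real K * \<beta>\<^sup>2" using K by (intro mult_right_mono) auto
    ultimately show ?thesis using K\<beta> by simp
  qed
  have "real K * (J0 / (real K - 1) + C\<^sub>D * (\<alpha>\<^sup>2 / real K + \<beta>\<^sup>2 + \<beta> / real K)
      + C\<^sub>1 * ((1 / sqrt (real K))\<^sup>2 + 1 / sqrt (real K) * sqrt (ln (real K) / real K)))
     = J0 * (real K / (real K - 1)) + C\<^sub>D * (\<alpha>\<^sup>2 + real K * \<beta>\<^sup>2 + \<beta>) + C\<^sub>1 * (1 + l)"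
    using K by (simp add: l_def distrib_left power_divide real_sqrt_divide)
  also have "\<dots> \<le> J0 * (2 * (P * Z)) + C\<^sub>D * (\<alpha>m\<^sup>2 * (P * Z) + Z + (P * Z / 2 + Z / 2)) + C\<^sub>1 * (P * Z + P * Z)"
  proof (intro add_mono mult_left_mono nn)
    have "real K / (real K - 1) \<le> 2" using K by (simp add: field_simps)
    then show "real K / (real K - 1) \<le> 2 * (P * Z)" using oneZ by linarith
    have "\<alpha>\<^sup>2 * 1 \<le> \<alpha>m\<^sup>2 * (P * Z)" using \<alpha> oneZ by (intro mult_mono power_mono) auto
    then show "\<alpha>\<^sup>2 \<le> \<alpha>m\<^sup>2 * (P * Z)" by simp
    show "real K * \<beta>\<^sup>2 \<le> Z" using K\<beta> xZ by linarith
    show "\<beta> \<le> P * Z / 2 + Z / 2" using \<beta>x xZ oneZ by linarith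
  qed (use oneZ lZ in auto)
  also have "\<dots> = (2 * J0 * P + C\<^sub>D * (\<alpha>m\<^sup>2 * P + 3 / 2 + P / 2) + 2 * C\<^sub>1 * P) * Z"
    by (simp add: algebra_simps)
  finally have main: "real K * (J0 / (real K - 1) + C\<^sub>D * (\<alpha>\<^sup>2 / real K + \<beta>\<^sup>2 + \<beta> / real K)
      + C\<^sub>1 * ((1 / sqrt (real K))\<^sup>2 + 1 / sqrt (real K) * sqrt (ln (real K) / real K)))
     \<le> (2 * J0 * P + C\<^sub>D * (\<alpha>m\<^sup>2 * P + 3 / 2 + P / 2) + 2 * C\<^sub>1 * P) * Z"
    (is "real K * ?S \<le> ?B * Z") .
  have R: "rate d \<alpha> K ^ (d + 2) = x / \<alpha> * (l / sqrt (real K))"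
  proof -
    have "real (d + 2) / (2 * (2 + real d)) = 1 / 2" by (simp add: field_simps)
    moreover have "\<alpha> powr (- (real (d + 2) / 2)) = x / \<alpha>"
    proof -
      have "- (real (d + 2) / 2) = - (real d / 2) + (- 1)" by (simp add: field_simps)
      then have "\<alpha> powr (- (real (d + 2) / 2)) = x * \<alpha> powr (- 1)" unfolding x_def by (simp only: powr_add)
      also have "\<alpha> powr (- 1) = 1 / \<alpha>" using \<alpha> by (simp add: powr_minus_divide)
      finally show ?thesis by simp
    qed
    ultimately have "rate d \<alpha> K ^ (d + 2) = x / \<alpha> * (ln (real K) / real K) powr (1 / 2)"
      using rate_power[OF K \<alpha>(1), of d "d + 2"] by (simp only:)
    also have "(ln (real K) / real K) powr (1 / 2) = l / sqrt (real K)"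
      using K by (simp add: l_def powr_half_sqrt real_sqrt_divide)
    finally show ?thesis .
  qed
  have "2 / \<alpha> * ?S = 2 / \<alpha> * (real K * ?S) / real K" using K by simp
  also have "\<dots> \<le> 2 / \<alpha> * (?B * Z) / real K"
    using main \<alpha> by (intro divide_right_mono mult_left_mono) auto
  also have "\<dots> = 2 * ?B / l2 * rate d \<alpha> K ^ (d + 2) / sqrt (real K)"
  proof -
    have "2 / \<alpha> * (B * Z) / (s * s) = 2 * B / l2 * (x / \<alpha> * (l / s)) / s" for B s :: real
      by (simp add: Z_def mult_ac)
    from this[of ?B "sqrt (real K)"] show ?thesis unfolding R by simp
  qed
  finally show ?thesis by (simp only: l2_def)
qed

text \<open>With radius \<open>R \<tau>\<close>, threshold \<open>A \<tau>\<close> and budget \<open>A3 \<tau>\<^bsup>d+2\<^esup> \<epsilon>\<close> every contribution to the gap is of order \<open>\<tau>\<close>.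
  Here \<open>e \<epsilon> \<tau>\<^sup>d / 2\<close> is the expected mass that exploration guarantees on each ball.
  The term coming from the dips is the critical one: its denominator is a multiple of \<open>\<epsilon> \<tau>\<^bsup>d+1\<^esup>\<close>.\<close>

lemma error_terms_le_rate:
  fixes \<tau> \<epsilon> m \<mu> A L R C\<^sub>2 A1 A3 S e :: real
  assumes \<tau>: "0 < \<tau>" "\<tau> \<le> 1" and \<epsilon>: "0 < \<epsilon>" "\<epsilon> \<le> 1" "\<epsilon> \<le> A1 * \<tau>"
    and nn: "\<mu> \<ge> 0" "C\<^sub>2 \<ge> 0" "A3 \<ge> 0" "A > 0" "e > 0"
    and S: "S \<le> A3 * \<tau> ^ (d + 2) * \<epsilon>"
  shows "1 / 2 * \<tau> * m + (A * \<tau> + L * (R * \<tau>) + C\<^sub>2 * \<epsilon>) * \<mu>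
      + (1 / (2 * \<tau>) + 4 * \<mu> / ((e * \<epsilon> * \<tau> ^ d / 2) * (A * \<tau>))) * S
    \<le> (m / 2 + (A + L * R + C\<^sub>2 * A1) * \<mu> + A3 / 2 + 8 * \<mu> * A3 / (e * A)) * \<tau>"
proof -
  have "(A * \<tau> + L * (R * \<tau>) + C\<^sub>2 * \<epsilon>) * \<mu> \<le> (A * \<tau> + L * (R * \<tau>) + C\<^sub>2 * (A1 * \<tau>)) * \<mu>"
    using \<epsilon> nn by (intro mult_right_mono add_left_mono mult_left_mono) auto
  moreover have "(1 / (2 * \<tau>) + 4 * \<mu> / ((e * \<epsilon> * \<tau> ^ d / 2) * (A * \<tau>))) * S
      \<le> (1 / (2 * \<tau>) + 4 * \<mu> / ((e * \<epsilon> * \<tau> ^ d / 2) * (A * \<tau>))) * (A3 * \<tau> ^ (d + 2) * \<epsilon>)"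
    using \<tau> \<epsilon> nn by (intro mult_left_mono S add_nonneg_nonneg) auto
  moreover have "\<dots> = A3 / 2 * (\<tau> * (\<tau> ^ d * \<epsilon>)) + 8 * \<mu> * A3 / (e * A) * \<tau>"
    using \<tau> \<epsilon> nn by (simp add: distrib_right power_add power2_eq_square)
  moreover have "A3 / 2 * (\<tau> * (\<tau> ^ d * \<epsilon>)) \<le> A3 / 2 * (\<tau> * (1 * 1))"
    using \<tau> \<epsilon> nn by (intro mult_left_mono mult_mono power_le_one) auto
  ultimately show ?thesis by (simp add: distrib_right distrib_left mult_ac)
qed

section \<open>The convergence rate\<close>

text \<open>The mass bound alone controls the first gap; this settles the case in which the rate is not small.\<close>

lemma (in kernel_problem) expected_best_gap_bounded:
  assumes M: "prob_space M" and \<nu>: "\<And>k \<omega>. \<omega> \<in> space M \<Longrightarrow> \<nu> k \<omega> \<in> nonneg_measures X"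
    and TV: "hyp_TV X M \<nu> m" and K: "K \<ge> 1" and \<mu>: "\<mu> \<in> nonneg_measures X"
  shows "m \<ge> 0" "prob_space.expectation M (best_gap J \<mu> \<nu> K) \<le> 1 / 2 * (m + CP)\<^sup>2 + \<kappa> * m"
proof -
  interpret prob_space M by (rule M)
  have "AE \<omega> in M. tv_norm X (measure (\<nu> 1 \<omega>)) \<le> m" using TV by (simp add: hyp_TV_def)
  then have mass: "AE \<omega> in M. measure (\<nu> 1 \<omega>) X \<le> m"
    using AE_space by eventually_elim (simp add: tv_norm_measure \<nu>)
  have "AE \<omega> in M. 0 \<le> m" using mass by eventually_elim (meson measure_nonneg order_trans)
  then show m: "m \<ge> 0" by simp
  have "expectation (best_gap J \<mu> \<nu> K) \<le> expectation (\<lambda>_. 1 / 2 * (m + CP)\<^sup>2 + \<kappa> * m)"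
  proof (rule integral_mono_AE')
    show "AE \<omega> in M. best_gap J \<mu> \<nu> K \<omega> \<le> 1 / 2 * (m + CP)\<^sup>2 + \<kappa> * m"
      using mass AE_space
    proof eventually_elim
      case (elim \<omega>)
      have "best_gap J \<mu> \<nu> K \<omega> \<le> J (\<nu> 1 \<omega>) - J \<mu>"
        unfolding best_gap_def using K by (intro Min_le) auto
      also have "\<dots> \<le> 1 / 2 * (m + CP)\<^sup>2 + \<kappa> * m"
        using objective_bounds(2)[OF \<nu> elim(1)] elim(2) objective_bounds(1)[OF \<mu> order_refl] by fastforce
      finally show ?case .
    qed
  qed (use m \<kappa>_pos in auto)
  then show "expectation (best_gap J \<mu> \<nu> K) \<le> 1 / 2 * (m + CP)\<^sup>2 + \<kappa> * m" by (simp add: prob_space)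
qed

text \<open>The empty set is compact, convex and the closure of its interior. It carries only the zero measure, so all
  gaps vanish there.\<close>

lemma objective_empty:
  assumes "\<nu> \<in> nonneg_measures {}" "\<mu> \<in> nonneg_measures {}"
  shows "objective {} \<Phi> y \<kappa> \<nu> = objective {} \<Phi> y \<kappa> \<mu>"
proof -
  have "measure \<eta> A = 0" if "\<eta> \<in> nonneg_measures {}" for \<eta> :: "'a measure" and A
  proof -
    interpret finite_measure \<eta> using nonneg_measuresD(1)[OF that] .
    have "measure \<eta> A \<le> 0" using bounded_measure[of A] nonneg_measuresD(2)[OF that] by simp
    then show ?thesis by (simp add: measure_le_0_iff)
  qed
  then have "measure \<nu> = measure \<mu>" using assms by auto
  then show ?thesis by (simp add: objective_def)
qed


theorem theorem3p1:
  fixes X :: "'a::euclidean_space set"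
    and \<Phi> :: "('a set \<Rightarrow> real) \<Rightarrow> 'h::{real_inner, banach, second_countable_topology}"
    and y :: 'h
    and \<kappa> cP CP CTV Einf G H a c\<^sub>E C\<^sub>E C\<^sub>D C\<^sub>1 C\<^sub>2 :: real
    and Q :: "'z measure"
    and J_hat :: "'a measure \<Rightarrow> 'a \<Rightarrow> 'z \<Rightarrow> real"
    and D_hat :: "'a measure \<Rightarrow> 'a \<Rightarrow> 'z \<Rightarrow> 'a"
    and \<nu>star :: "'a measure"
  assumes "domain_ok X"
    and "measurement_operator X \<Phi>"
    and "\<kappa> > 0"
    and "problem_assumption X \<Phi> y cP CP"
    and "stochastic_gradients X \<Phi> y \<kappa> CTV Q J_hat D_hat Einf G H"
    and "c\<^sub>E > 0" "C\<^sub>E > 0" "C\<^sub>D > 0" "C\<^sub>1 > 0" "C\<^sub>2 > 0"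
    and "a > 0" "a \<ge> real DIM('a) / (2 * (2 + real DIM('a)))"
    and "is_arg_min (objective X \<Phi> y \<kappa>) (\<lambda>\<nu>. \<nu> \<in> nonneg_measures X) \<nu>star"
  shows "\<exists>C>0. \<forall>K\<ge>2. \<forall>\<alpha> \<beta>.
      \<forall>(M :: 'w measure) F Fp (\<nu> :: nat \<Rightarrow> 'w \<Rightarrow> 'a measure) (\<nu>p :: nat \<Rightarrow> 'w \<Rightarrow> 'a measure).
      0 < \<alpha> \<and> \<alpha> \<le> 1 / Einf * sqrt (8 * ln 8) \<and>
      0 < \<beta> \<and> \<beta> \<le> 1 / (\<alpha> powr (real DIM('a) / 4) * sqrt (real K)) \<and>
      prob_space M \<and> interlaced_filtrations M F Fp \<and>
      measure_adapted X M F \<nu> \<and> measure_adapted X M Fp \<nu>p \<and>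
      hyp_TV X M \<nu> CTV \<and>
      hyp_D (objective X \<Phi> y \<kappa>) (objective' X \<Phi> y \<kappa>) M F \<nu> \<nu>p \<alpha> \<beta> (\<lambda>k. K) C\<^sub>D \<and>
      hyp_plus X (objective' X \<Phi> y \<kappa>) M Fp \<nu> \<nu>p (\<lambda>k. 1 / sqrt (real K)) (\<lambda>k. K) a c\<^sub>E C\<^sub>E \<and>
      hyp_smooth1 (objective X \<Phi> y \<kappa>) M Fp \<nu> \<nu>p (\<lambda>k. 1 / sqrt (real K)) (\<lambda>k. K) C\<^sub>1 \<and>
      hyp_smooth2 X (objective' X \<Phi> y \<kappa>) M \<nu> \<nu>p (\<lambda>k. 1 / sqrt (real K)) C\<^sub>2
      \<longrightarrow> prob_space.expectation M (best_gap (objective X \<Phi> y \<kappa>) \<nu>star \<nu> K)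
          \<le> C * \<alpha> powr (- (1 / 2)) * (ln (real K) / real K) powr (1 / (2 * (2 + real DIM('a))))"
proof (cases "X = {}")
  case True
  show ?thesis
  proof (intro exI[of _ 1] conjI allI impI)
    fix K :: nat and \<alpha> \<beta> :: real and M :: "'w measure" and F Fp and \<nu> \<nu>p :: "nat \<Rightarrow> 'w \<Rightarrow> 'a measure"
    assume K: "K \<ge> 2" and run: "0 < \<alpha> \<and> \<alpha> \<le> 1 / Einf * sqrt (8 * ln 8) \<and>
      0 < \<beta> \<and> \<beta> \<le> 1 / (\<alpha> powr (real DIM('a) / 4) * sqrt (real K)) \<and>
      prob_space M \<and> interlaced_filtrations M F Fp \<and>
      measure_adapted X M F \<nu> \<and> measure_adapted X M Fp \<nu>p \<and>
      hyp_TV X M \<nu> CTV \<and>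
      hyp_D (objective X \<Phi> y \<kappa>) (objective' X \<Phi> y \<kappa>) M F \<nu> \<nu>p \<alpha> \<beta> (\<lambda>k. K) C\<^sub>D \<and>
      hyp_plus X (objective' X \<Phi> y \<kappa>) M Fp \<nu> \<nu>p (\<lambda>k. 1 / sqrt (real K)) (\<lambda>k. K) a c\<^sub>E C\<^sub>E \<and>
      hyp_smooth1 (objective X \<Phi> y \<kappa>) M Fp \<nu> \<nu>p (\<lambda>k. 1 / sqrt (real K)) (\<lambda>k. K) C\<^sub>1 \<and>
      hyp_smooth2 X (objective' X \<Phi> y \<kappa>) M \<nu> \<nu>p (\<lambda>k. 1 / sqrt (real K)) C\<^sub>2"
    have "best_gap (objective X \<Phi> y \<kappa>) \<nu>star \<nu> K \<omega> = 0" if "\<omega> \<in> space M" for \<omega>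
    proof -
      have \<nu>k: "\<nu> k \<omega> \<in> nonneg_measures {}" for k
        using run that True by (simp add: measure_adapted_def)
      have \<nu>s: "\<nu>star \<in> nonneg_measures {}" using assms(13) True by (simp add: is_arg_min_def)
      have "objective X \<Phi> y \<kappa> (\<nu> k \<omega>) - objective X \<Phi> y \<kappa> \<nu>star = 0" for k
        unfolding True objective_empty[OF \<nu>k \<nu>s] by (rule diff_self)
      moreover have "(\<lambda>_. 0 :: real) ` {1..K} = {0}" using K by (simp add: image_constant_conv)
      ultimately have "(\<lambda>k. objective X \<Phi> y \<kappa> (\<nu> k \<omega>) - objective X \<Phi> y \<kappa> \<nu>star) ` {1..K} = {0}"
        by (simp only:)
      then show ?thesis unfolding best_gap_def by (simp only: Min_singleton)
    qed
    then have "prob_space.expectation M (best_gap (objective X \<Phi> y \<kappa>) \<nu>star \<nu> K) = (\<integral>\<omega>. 0 \<partial>M)"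
      by (intro Bochner_Integration.integral_cong) auto
    then show "prob_space.expectation M (best_gap (objective X \<Phi> y \<kappa>) \<nu>star \<nu> K) \<le>
      1 * \<alpha> powr (- (1 / 2)) * (ln (real K) / real K) powr (1 / (2 * (2 + real DIM('a))))" by simp
  qed simp
next
  case False
  interpret kernel_problem X \<Phi> y \<kappa> cP CP
    by unfold_locales (use assms False in auto)
  define d where "d = DIM('a)"
  define \<alpha>m where "\<alpha>m = 1 / Einf * sqrt (8 * ln 8)"
  define \<mu> where "\<mu> = measure \<nu>star X"
  have \<nu>star: "\<nu>star \<in> nonneg_measures X" "\<And>\<nu>. \<nu> \<in> nonneg_measures X \<Longrightarrow> J \<nu>star \<le> J \<nu>"
    using assms(13) by (auto simp: is_arg_min_def not_less)
  have d: "d \<ge> 1" unfolding d_def by (simp add: Suc_leI)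
  have "interior X \<noteq> {}" using assms(1) False unfolding domain_ok_def by auto
  then obtain v where v: "v > 0"
    "\<And>t r. t \<in> X \<Longrightarrow> 0 < r \<Longrightarrow> r \<le> 1 \<Longrightarrow> v * r ^ DIM('a) \<le> measure lborel (X \<inter> cball t r)"
    using convex_cball_volume[OF X_compact X_convex] by metis
  obtain L0 where L0: "L0 \<ge> 0" "\<And>\<nu> s t. \<nu> \<in> nonneg_measures X \<Longrightarrow> s \<in> X \<Longrightarrow> t \<in> X \<Longrightarrow>
      \<bar>J' \<nu> s - J' \<nu> t\<bar> \<le> L0 * (measure \<nu> X + CP) * dist s t"
    by (rule objective'_lipschitz) (rule that)
  \<comment> \<open>The absolute value keeps \<open>L\<close> nonnegative; only the existence of a run shows \<open>CTV \<ge> 0\<close>.\<close>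
  define L where "L = L0 * (\<bar>CTV\<bar> + CP)"
  have L: "L \<ge> 0" using L0(1) CP_pos by (simp add: L_def)
  have lip: "\<bar>J' \<nu> s - J' \<nu> t\<bar> \<le> L * dist s t"
    if "\<nu> \<in> nonneg_measures X" "measure \<nu> X \<le> CTV" "s \<in> X" "t \<in> X" for \<nu> s t
  proof -
    have "L0 * (measure \<nu> X + CP) * dist s t \<le> L * dist s t"
      unfolding L_def using that(2) L0(1) by (intro mult_right_mono mult_left_mono) auto
    then show ?thesis using L0(2)[OF that(1,3,4)] by linarith
  qed
  define A1 where "A1 = \<alpha>m powr (real 1 / 2) / ln 2"
  define A2 where "A2 = \<alpha>m powr (real d / 2) / ln 2"
  have A12: "A1 \<ge> 0" "A2 \<ge> 0" by (simp_all add: A1_def A2_def)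
  \<comment> \<open>For this \<open>R\<close>, \<open>c\<^sub>E\<close> times the volume of \<open>X \<inter> cball t (R \<tau>)\<close> is at least twice the error \<open>C\<^sub>E K\<^bsup>-a\<^esup>\<close>.\<close>
  define R where "R = max 1 (2 * C\<^sub>E * A2 / (c\<^sub>E * v))"
  have R: "R \<ge> 1" by (simp add: R_def)
  have RA2: "C\<^sub>E * A2 \<le> c\<^sub>E * v * R ^ d / 2"
  proof -
    have "2 * C\<^sub>E * A2 / (c\<^sub>E * v) \<le> R" by (simp add: R_def)
    also have "R \<le> R ^ d" using R d self_le_power[of R d] by simp
    finally show ?thesis using v(1) assms(6) by (simp add: field_simps)
  qed
  \<comment> \<open>\<open>A \<tau>\<close> is an admissible threshold for dips, as \<open>\<epsilon> \<le> A1 \<tau>\<close>.\<close>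
  define A where "A = 2 * (L * R + 2 * (C\<^sub>2 * A1)) + 1"
  have A: "A > 0"
    unfolding A_def using L R assms(10) A12
    by (intro add_nonneg_pos mult_nonneg_nonneg add_nonneg_nonneg) auto
  define J0 where "J0 = 1 / 2 * (CTV + CP)\<^sup>2 + \<kappa> * CTV"
  define P where "P = \<alpha>m powr (real d / 2)"
  define A3 where "A3 = 2 * (2 * J0 * P + C\<^sub>D * (\<alpha>m\<^sup>2 * P + 3 / 2 + P / 2) + 2 * C\<^sub>1 * P) / sqrt (ln 2)"
  define e where "e = c\<^sub>E * v * R ^ d"
  have e: "e > 0" using assms(6) v(1) R by (simp add: e_def)
  \<comment> \<open>The two nontrivial entries belong to the cases \<open>R \<tau> > 1\<close> and \<open>R \<tau> \<le> 1\<close>.\<close>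
  define C where "C = max 1 (max (J0 * R)
      (CTV / 2 + (A + L * R + C\<^sub>2 * A1) * \<mu> + A3 / 2 + 8 * \<mu> * A3 / (e * A)))"
  show ?thesis
  proof (intro exI[of _ C] conjI allI impI)
    show "C > 0" by (simp add: C_def)
    fix K :: nat and \<alpha> \<beta> :: real and M :: "'w measure" and F Fp and \<nu> \<nu>p :: "nat \<Rightarrow> 'w \<Rightarrow> 'a measure"
    assume K: "K \<ge> 2" and run: "0 < \<alpha> \<and> \<alpha> \<le> 1 / Einf * sqrt (8 * ln 8) \<and>
      0 < \<beta> \<and> \<beta> \<le> 1 / (\<alpha> powr (real DIM('a) / 4) * sqrt (real K)) \<and>
      prob_space M \<and> interlaced_filtrations M F Fp \<and>
      measure_adapted X M F \<nu> \<and> measure_adapted X M Fp \<nu>p \<and>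
      hyp_TV X M \<nu> CTV \<and>
      hyp_D (objective X \<Phi> y \<kappa>) (objective' X \<Phi> y \<kappa>) M F \<nu> \<nu>p \<alpha> \<beta> (\<lambda>k. K) C\<^sub>D \<and>
      hyp_plus X (objective' X \<Phi> y \<kappa>) M Fp \<nu> \<nu>p (\<lambda>k. 1 / sqrt (real K)) (\<lambda>k. K) a c\<^sub>E C\<^sub>E \<and>
      hyp_smooth1 (objective X \<Phi> y \<kappa>) M Fp \<nu> \<nu>p (\<lambda>k. 1 / sqrt (real K)) (\<lambda>k. K) C\<^sub>1 \<and>
      hyp_smooth2 X (objective' X \<Phi> y \<kappa>) M \<nu> \<nu>p (\<lambda>k. 1 / sqrt (real K)) C\<^sub>2"
    then have \<alpha>: "0 < \<alpha>" "\<alpha> \<le> \<alpha>m"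
      and \<beta>: "0 < \<beta>" "\<beta> \<le> 1 / (\<alpha> powr (real d / 4) * sqrt (real K))"
      and M: "prob_space M" and filt: "interlaced_filtrations M F Fp"
      and ad: "measure_adapted X M F \<nu>" "measure_adapted X M Fp \<nu>p"
      and TV: "hyp_TV X M \<nu> CTV"
      and D: "hyp_D J J' M F \<nu> \<nu>p \<alpha> \<beta> (\<lambda>k. K) C\<^sub>D"
      and plus: "hyp_plus X J' M Fp \<nu> \<nu>p (\<lambda>k. 1 / sqrt (real K)) (\<lambda>k. K) a c\<^sub>E C\<^sub>E"
      and sm1: "hyp_smooth1 J M Fp \<nu> \<nu>p (\<lambda>k. 1 / sqrt (real K)) (\<lambda>k. K) C\<^sub>1"
      and sm2: "hyp_smooth2 X J' M \<nu> \<nu>p (\<lambda>k. 1 / sqrt (real K)) C\<^sub>2"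
      by (simp_all add: \<alpha>m_def d_def)
    define \<tau> where "\<tau> = rate d \<alpha> K"
    have \<tau>: "\<tau> > 0" unfolding \<tau>_def by (rule rate_pos[OF K \<alpha>(1)])
    have \<nu>: "\<nu> k \<omega> \<in> nonneg_measures X" if "\<omega> \<in> space M" for k \<omega>
      using ad(1) that by (simp add: measure_adapted_def)
    have K1: "K \<ge> 1" using K by simp
    have CTV: "CTV \<ge> 0" by (rule expected_best_gap_bounded(1)[OF M \<nu> TV K1 \<nu>star(1)])
    have triv: "prob_space.expectation M (best_gap J \<nu>star \<nu> K) \<le> J0"
      unfolding J0_def by (rule expected_best_gap_bounded(2)[OF M \<nu> TV K1 \<nu>star(1)])
    have J0: "J0 \<ge> 0" unfolding J0_def using CTV \<kappa>_pos by simp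
    have "prob_space.expectation M (best_gap J \<nu>star \<nu> K) \<le> C * \<tau>"
    proof (cases "R * \<tau> \<le> 1")
      case False
      have "J0 * 1 \<le> J0 * (R * \<tau>)" using False J0 by (intro mult_left_mono) auto
      also have "\<dots> = J0 * R * \<tau>" by simp
      also have "\<dots> \<le> C * \<tau>" using \<tau> by (intro mult_right_mono) (auto simp: C_def)
      finally show ?thesis using triv by simp
    next
      case True
      define \<epsilon> where "\<epsilon> = 1 / sqrt (real K)"
      have \<epsilon>: "0 < \<epsilon>" "\<epsilon> \<le> 1" using K by (auto simp: \<epsilon>_def)
      have \<epsilon>\<tau>: "\<epsilon> \<le> A1 * \<tau>"
      proof -
        have "real K powr (- (1 / 2)) \<le> A1 * \<tau> ^ 1"
          unfolding A1_def \<tau>_def by (rule rate_power_ge[OF K \<alpha>]) (auto simp: field_simps)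
        then show ?thesis using K by (simp add: \<epsilon>_def powr_minus_divide powr_half_sqrt)
      qed
      have Ka: "real K powr (- a) \<le> A2 * \<tau> ^ d"
        unfolding A2_def \<tau>_def by (rule rate_power_ge[OF K \<alpha>]) (use assms(12) in \<open>auto simp: d_def\<close>)
      have \<tau>1: "\<tau> \<le> 1"
      proof -
        have "1 * \<tau> \<le> R * \<tau>" using R \<tau> by (intro mult_right_mono) auto
        then show ?thesis using True by simp
      qed
      have b: "0 < e * \<epsilon> * \<tau> ^ d / 2" using e \<epsilon> \<tau> by simp
      have b': "e * \<epsilon> * \<tau> ^ d / 2 \<le> c\<^sub>E * \<epsilon> * (v * (R * \<tau>) ^ d) - C\<^sub>E * \<epsilon> * real K powr (- a)"
      proof -
        have "C\<^sub>E * \<epsilon> * real K powr (- a) \<le> C\<^sub>E * \<epsilon> * (A2 * \<tau> ^ d)"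
          using Ka assms(7) \<epsilon> by (intro mult_left_mono) auto
        also have "\<dots> = (C\<^sub>E * A2) * (\<epsilon> * \<tau> ^ d)" by simp
        also have "\<dots> \<le> (c\<^sub>E * v * R ^ d / 2) * (\<epsilon> * \<tau> ^ d)"
          using RA2 \<epsilon> \<tau> by (intro mult_right_mono) auto
        finally show ?thesis by (simp add: e_def power_mult_distrib mult_ac)
      qed
      have \<theta>: "2 * (L * (R * \<tau>) + 2 * (C\<^sub>2 * \<epsilon>)) \<le> A * \<tau>"
      proof -
        have "C\<^sub>2 * \<epsilon> \<le> C\<^sub>2 * (A1 * \<tau>)" using \<epsilon>\<tau> assms(10) by simp
        then show ?thesis using \<tau> by (simp add: A_def algebra_simps)
      qed
      have "prob_space.expectation M (best_gap J \<nu>star \<nu> K) \<le>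
        1 / 2 * \<tau> * CTV + (A * \<tau> + L * (R * \<tau>) + C\<^sub>2 * \<epsilon>) * \<mu> +
        (1 / (2 * \<tau>) + 4 * \<mu> / ((e * \<epsilon> * \<tau> ^ d / 2) * (A * \<tau>))) *
        (2 / \<alpha> * (J0 / (real K - 1) + C\<^sub>D * (\<alpha>\<^sup>2 / real K + \<beta>\<^sup>2 + \<beta> / real K)
         + C\<^sub>1 * (\<epsilon>\<^sup>2 + \<epsilon> * sqrt (ln (real K) / real K))))"
        unfolding J0_def \<mu>_def
      proof (rule expected_best_gap_le[OF M filt ad TV D])
        show "v * (R * \<tau>) ^ d \<le> measure lborel (X \<inter> cball t (R * \<tau>))" if "t \<in> X" for t
          using v(2)[OF that _ True] R \<tau> by (simp add: d_def)
        show "hyp_plus X J' M Fp \<nu> \<nu>p (\<lambda>k. \<epsilon>) (\<lambda>k. K) a c\<^sub>E C\<^sub>E" using plus by (simp only: \<epsilon>_def)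
        show "hyp_smooth1 J M Fp \<nu> \<nu>p (\<lambda>k. \<epsilon>) (\<lambda>k. K) C\<^sub>1" using sm1 by (simp only: \<epsilon>_def)
        show "hyp_smooth2 X J' M \<nu> \<nu>p (\<lambda>k. \<epsilon>) C\<^sub>2" using sm2 by (simp only: \<epsilon>_def)
        show "\<And>\<nu> s t. \<nu> \<in> nonneg_measures X \<Longrightarrow> measure \<nu> X \<le> CTV \<Longrightarrow> s \<in> X \<Longrightarrow> t \<in> X \<Longrightarrow>
          \<bar>J' \<nu> s - J' \<nu> t\<bar> \<le> L * dist s t" by (rule lip)
        show "\<And>\<nu>. \<nu> \<in> nonneg_measures X \<Longrightarrow> J \<nu>star \<le> J \<nu>" by (rule \<nu>star(2))
        show "0 < R * \<tau>" using R \<tau> by simp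
        show "0 < A * \<tau>" using A \<tau> by simp
      qed (use K \<alpha> \<epsilon> assms(6) L \<theta> b b' \<tau> \<nu>star(1) in auto)
      also have "\<dots> \<le> (CTV / 2 + (A + L * R + C\<^sub>2 * A1) * \<mu> + A3 / 2 + 8 * \<mu> * A3 / (e * A)) * \<tau>"
      proof (rule error_terms_le_rate[OF \<tau> \<tau>1 \<epsilon> \<epsilon>\<tau> _ _ _ A e])
        show "0 \<le> \<mu>" by (simp add: \<mu>_def)
        show "0 \<le> C\<^sub>2" using assms(10) by simp
        have "P \<ge> 0" by (simp add: P_def)
        then show "0 \<le> A3" unfolding A3_def using J0 assms(8,9)
          by (intro divide_nonneg_nonneg mult_nonneg_nonneg add_nonneg_nonneg) auto
        have "C\<^sub>D \<ge> 0" "C\<^sub>1 \<ge> 0" using assms(8,9) by auto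
        from averaged_descent_le[OF K \<alpha> J0 this \<beta>]
        show "2 / \<alpha> * (J0 / (real K - 1) + C\<^sub>D * (\<alpha>\<^sup>2 / real K + \<beta>\<^sup>2 + \<beta> / real K)
         + C\<^sub>1 * (\<epsilon>\<^sup>2 + \<epsilon> * sqrt (ln (real K) / real K))) \<le> A3 * \<tau> ^ (d + 2) * \<epsilon>"
          unfolding A3_def P_def \<tau>_def \<epsilon>_def by (simp only: times_divide_eq_right mult_1_right)
      qed
      also have "\<dots> \<le> C * \<tau>" using \<tau> by (intro mult_right_mono) (auto simp: C_def)
      finally show ?thesis .
    qed
    then show "prob_space.expectation M (best_gap J \<nu>star \<nu> K) \<le>
      C * \<alpha> powr (- (1 / 2)) * (ln (real K) / real K) powr (1 / (2 * (2 + real DIM('a))))"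
      by (simp add: \<tau>_def rate_def d_def mult.assoc)
  qed
qed

end
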